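(* Let $K,M,T\ge 1$ be integers and $G=([K],E)$ a strongly observable directed graph. For general (arbitrary) context sequences, there is a policy $\pi$ achieving $$R_T(\pi;G,M)=\widetilde{O}\Big(\sqrt{\min\{\overline{\beta}_M(G),\mathsf{m}(G)\}\,T}\Big),$$ where $\mathsf{m}(G)$ is the maximum acyclic subgraph number of $G$ and $$\overline{\beta}_M(G)=\max\Big\{\sum_{c=1}^M |I_c| : I_1,\dots,I_M \text{ are disjoint independent subsets of } [K]\Big\}.$$
   Context: Graph conventions: $[n]=\{1,\dots,n\}$. For a directed graph $G=([K],E)$ (self-loops allowed), $u\to v$ means $(u,v)\in E$. A set $I\subseteq[K]$ is independent if $(u,v)\notin E$ for all distinct $u,v\in I$ (the empty set is allowed). $G$ is strongly observable if for every $a\in[K]$, either $a\to a$ or $a'\to a$ for all $a'\ne a$. The maximum acyclic subgraph (MAS) number is $\mathsf{m}(G)=\max\{|D|: D\subseteq[K]$ induces an acyclic subgraph of $G\}$, where acyclic means having no directed cycle other than self-loops. Stochastic contextual bandits with graph feedback and complete cross-learning: there are $M$ contexts, $K$ actions, a horizon $T$, and a known feedback graph $G$ on the actions. An environment consists of unknown means $\mu=(\mu_{c,a})_{c\in[M],a\in[K]}\in[0,1]^{M\times K}$ and reward vectors $(r_{t,c,a})_{c\in[M],a\in[K]}$, $t\in[T]$, independent across $t$, with $r_{t,c,a}\in[0,1]$ and $\mathbb{E}[r_{t,c,a}]=\mu_{c,a}$. An oblivious adversary fixes a context sequence $c^T=(c_1,\dots,c_T)\in[M]^T$. In each round $t$,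 the context $c_t$ is revealed, the learner (knowing $T,K,M,G$) chooses an action $a_t=\pi_t(c_t)\in[K]$ (possibly at random) based on past observations and $c_t$, and then observes $r_{t,c,a}$ for all $c\in[M]$ and all $a$ with $(a_t,a)\in E$. The regret of a policy $\pi$ is $$R_T(\pi;G,M)=\sup_{c^T}\ \sup_{\mu}\ \mathbb{E}\Big[\sum_{t=1}^T\big(\max_{a\in[K]}\mu_{c_t,a}-\mu_{c_t,a_t}\big)\Big],$$ the supremum being over all context sequences and all environments. $\widetilde{O}(\cdot)$ hides absolute constants and factors polylogarithmic in $K,M,T$. *)

theory Defs
  imports "HOL-Probability.Probability"
begin

section \<open>Feedback graphs\<close>

text \<open>
  A directed graph on the vertex set \<open>[K] = {1..K}\<close> is given by its edge relation \<open>E\<close>,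
  where \<open>(u, v) \<in> E\<close> stands for \<open>u \<rightarrow> v\<close>; self-loops are allowed.
\<close>

definition digraph_on :: "nat \<Rightarrow> nat rel \<Rightarrow> bool" where
  "digraph_on K E \<longleftrightarrow> E \<subseteq> {1..K} \<times> {1..K}"

definition strongly_observable :: "nat \<Rightarrow> nat rel \<Rightarrow> bool" where
  "strongly_observable K E \<longleftrightarrow>
     (\<forall>a\<in>{1..K}. (a, a) \<in> E \<or> (\<forall>a'\<in>{1..K}. a' \<noteq> a \<longrightarrow> (a', a) \<in> E))"

definition independent_set :: "nat \<Rightarrow> nat rel \<Rightarrow> nat set \<Rightarrow> bool" where
  "independent_set K E I \<longleftrightarrow>
     I \<subseteq> {1..K} \<and> (\<forall>u\<in>I. \<forall>v\<in>I. u \<noteq> v \<longrightarrow> (u, v) \<notin> E)"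

text \<open>Subtracting \<open>Id\<close> discards the self-loops, which do not count as cycles.\<close>

definition mas_number :: "nat \<Rightarrow> nat rel \<Rightarrow> nat" where
  "mas_number K E =
     Max {card D | D. D \<subseteq> {1..K} \<and> acyclic ((E \<inter> D \<times> D) - Id)}"

definition beta_bar :: "nat \<Rightarrow> nat \<Rightarrow> nat rel \<Rightarrow> nat" where
  "beta_bar M K E =
     Max {(\<Sum>c=1..M. card (I c)) | I.
            (\<forall>c\<in>{1..M}. independent_set K E (I c)) \<and> disjoint_family_on I {1..M}}"


section \<open>Contextual bandits with graph feedback and complete cross-learning\<close>

text \<open>
  Contexts are \<open>1..M\<close>, actions are \<open>1..K\<close>; rounds are numbered from \<open>0\<close> to \<open>T - 1\<close>, so
  that context and action sequences are lists.  A reward table \<open>\<omega>\<close> assigns to round \<open>t\<close>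
  the reward vector \<open>\<omega> t\<close>, whose \<open>(c, a)\<close> entry is \<open>r\<^sub>t\<^sub>,\<^sub>c\<^sub>,\<^sub>a\<close>.
\<close>

type_synonym reward_table = "nat \<Rightarrow> nat \<times> nat \<Rightarrow> real"

abbreviation reward_space :: "nat \<Rightarrow> nat \<Rightarrow> (nat \<times> nat \<Rightarrow> real) measure" where
  "reward_space K M \<equiv> Pi\<^sub>M ({1..M} \<times> {1..K}) (\<lambda>_. borel)"

abbreviation table_space :: "nat \<Rightarrow> nat \<Rightarrow> nat \<Rightarrow> reward_table measure" where
  "table_space K M n \<equiv> Pi\<^sub>M {..<n} (\<lambda>_. reward_space K M)"

text \<open>
  An environment is a mean vector \<open>\<mu>\<close> and a joint law \<open>P\<close> of the reward table.  Nothing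
  is lost by letting the rewards be the coordinates of the canonical sample space: the
  regret depends on them only through their joint law.  The entries of a single reward
  vector may be dependent, and the laws of the vectors may change with the round.
\<close>

definition environment ::
  "nat \<Rightarrow> nat \<Rightarrow> nat \<Rightarrow> (nat \<Rightarrow> nat \<Rightarrow> real) \<Rightarrow> reward_table measure \<Rightarrow> bool" where
  "environment K M T \<mu> P \<longleftrightarrow>
     prob_space P \<and>
     sets P = sets (table_space K M T) \<and>
     prob_space.indep_vars P (\<lambda>_. reward_space K M) (\<lambda>t \<omega>. \<omega> t) {..<T} \<and>
     (\<forall>c\<in>{1..M}. \<forall>a\<in>{1..K}. \<mu> c a \<in> {0..1}) \<and>
     (\<forall>t<T. \<forall>c\<in>{1..M}. \<forall>a\<in>{1..K}.
        (AE \<omega> in P. \<omega> t (c, a) \<in> {0..1}) \<and>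
        (\<integral>\<omega>. \<omega> t (c, a) \<partial>P) = \<mu> c a)"

text \<open>
  What the learner has seen after playing the actions \<open>as\<close>: in a past round \<open>s\<close> the
  rewards of all contexts and of all actions \<open>a\<close> with \<open>as ! s \<rightarrow> a\<close>.  All other entries
  are blanked out by \<open>0\<close>; which ones these are is determined by \<open>as\<close> and the graph.
\<close>

definition observed ::
  "nat \<Rightarrow> nat \<Rightarrow> nat rel \<Rightarrow> nat list \<Rightarrow> reward_table \<Rightarrow> reward_table" where
  "observed K M E as \<omega> =
     (\<lambda>s\<in>{..<length as}. \<lambda>(c, a)\<in>{1..M} \<times> {1..K}.
        if (as ! s, a) \<in> E then \<omega> s (c, a) else 0)"

text \<open>
  A randomized policy maps the contexts up to and including the current one, the past
  actions and the past observations to the distribution of the next action.  Fresh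
  randomness may be used in every round, independently of the rewards.
\<close>

type_synonym bandit_policy = "nat list \<Rightarrow> nat list \<Rightarrow> reward_table \<Rightarrow> nat pmf"

definition context_seqs :: "nat \<Rightarrow> nat \<Rightarrow> nat list set" where
  "context_seqs M n = {cs. length cs = n \<and> set cs \<subseteq> {1..M}}"

text \<open>
  Measurability in the observations guarantees that the expectations below are genuine;
  in the contexts and actions it is automatic.
\<close>

definition valid_policy :: "nat \<Rightarrow> nat \<Rightarrow> nat \<Rightarrow> bandit_policy \<Rightarrow> bool" where
  "valid_policy K M T \<pi> \<longleftrightarrow>
     (\<forall>t<T. \<forall>cs\<in>context_seqs M (Suc t). \<forall>as. length as = t \<and> set as \<subseteq> {1..K} \<longrightarrow>
        (\<forall>h\<in>space (table_space K M t). set_pmf (\<pi> cs as h) \<subseteq> {1..K}) \<and>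
        (\<forall>a. (\<lambda>h. pmf (\<pi> cs as h) a) \<in> borel_measurable (table_space K M t)))"

text \<open>
  The distribution of the first \<open>t\<close> actions, for a fixed reward table and context sequence.
\<close>

primrec play ::
  "nat \<Rightarrow> nat \<Rightarrow> nat rel \<Rightarrow> bandit_policy \<Rightarrow> nat list \<Rightarrow> reward_table \<Rightarrow> nat \<Rightarrow> nat list pmf"
where
  "play K M E \<pi> cs \<omega> 0 = return_pmf []"
| "play K M E \<pi> cs \<omega> (Suc t) =
     bind_pmf (play K M E \<pi> cs \<omega> t)
       (\<lambda>as. map_pmf (\<lambda>a. as @ [a]) (\<pi> (take (Suc t) cs) as (observed K M E as \<omega>)))"

definition pseudo_regret ::
  "nat \<Rightarrow> (nat \<Rightarrow> nat \<Rightarrow> real) \<Rightarrow> nat list \<Rightarrow> nat list \<Rightarrow> real" where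
  "pseudo_regret K \<mu> cs as =
     (\<Sum>t<length cs. (MAX a\<in>{1..K}. \<mu> (cs ! t) a) - \<mu> (cs ! t) (as ! t))"

definition expected_regret ::
  "nat \<Rightarrow> nat \<Rightarrow> nat rel \<Rightarrow> bandit_policy \<Rightarrow> nat list
    \<Rightarrow> (nat \<Rightarrow> nat \<Rightarrow> real) \<Rightarrow> reward_table measure \<Rightarrow> real" where
  "expected_regret K M E \<pi> cs \<mu> P =
     (\<integral>\<omega>. measure_pmf.expectation (play K M E \<pi> cs \<omega> (length cs)) (pseudo_regret K \<mu> cs) \<partial>P)"

text \<open>Extended reals make the supremum meaningful without a boundedness argument.\<close>

definition regret :: "nat \<Rightarrow> nat \<Rightarrow> nat \<Rightarrow> nat rel \<Rightarrow> bandit_policy \<Rightarrow> ereal" where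
  "regret K M T E \<pi> =
     (SUP cs\<in>context_seqs M T. SUP (\<mu>, P)\<in>{(\<mu>, P). environment K M T \<mu> P}.
        ereal (expected_regret K M E \<pi> cs \<mu> P))"

end

theory Submission
  imports Defs
begin

text \<open>
  Each context keeps the arms that no confidence interval has eliminated so far, and in a round
  one plays, among the active arms observed least often, an arm that observes as many of these as
  possible.  If the least count is \<open>n\<close>, the gap of the played arm is \<open>O(sqrt (log / n))\<close>, so everything
  depends on the number of rounds with least count at most \<open>n\<close>; it is at most \<open>n + 1\<close> times either
  quantity in the minimum, up to logarithms.

  For the acyclic subgraph number, the played arms have at most \<open>n\<close> forward in-arcs in the order of
  play; a greedy colouring leaves a fraction \<open>1 / (n + 1)\<close> of the rounds without forward arcs, which
  induces an acyclic subgraph.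

  For the disjoint independent sets, let \<open>B c\<close> be the arms whose observation number \<open>n + 1\<close> takes
  place in context \<open>c\<close>; these sets are disjoint.  As in the greedy set cover, context \<open>c\<close> needs at most
  \<open>O(log K)\<close> times the independence number of \<open>B c\<close> rounds, because a set without large
  out-degrees contains a large independent set.

  Which rewards are observed depends on the past, so the confidence intervals rest on a Hoeffding
  bound for predictably sampled sums.
\<close>

subsection \<open>Independent sets and greedy covers\<close>

text \<open>Colour greedily in increasing order with \<open>n + 1\<close> colours: the at most
  \<open>n\<close> earlier \<open>R\<close>-neighbours of an element leave one colour free.
  \<open>I\<close> is a colour class of at least average size.\<close>

lemma forward_sparse_independent:
  fixes W :: "nat set" and R :: "nat \<Rightarrow> nat \<Rightarrow> bool"
  assumes "finite W" and sparse: "\<And>t. t \<in> W \<Longrightarrow> card {s \<in> W. s < t \<and> R s t} \<le> n"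
  obtains I where "I \<subseteq> W" "card W \<le> Suc n * card I" "\<And>s t. s \<in> I \<Longrightarrow> t \<in> I \<Longrightarrow> s < t \<Longrightarrow> \<not> R s t"
proof -
  have "\<exists>col. col ` W \<subseteq> {..n} \<and> (\<forall>s\<in>W. \<forall>t\<in>W. s < t \<and> R s t \<longrightarrow> col s \<noteq> (col t :: nat))"
    using assms
  proof (induction rule: finite_linorder_max_induct)
    case empty
    then show ?case by auto
  next
    case (insert t W)
    have "card {s \<in> W. s < t' \<and> R s t'} \<le> n" if "t' \<in> W" for t'
    proof -
      have "card {s \<in> W. s < t' \<and> R s t'} \<le> card {s \<in> insert t W. s < t' \<and> R s t'}"
        using insert.hyps by (intro card_mono) auto
      then show ?thesis
        using insert.prems[of t'] that by simp
    qed
    then obtain col where col: "col ` W \<subseteq> {..n}"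
        "\<forall>s\<in>W. \<forall>t\<in>W. s < t \<and> R s t \<longrightarrow> col s \<noteq> (col t :: nat)"
      using insert.IH by blast
    \<comment> \<open>\<open>t\<close> exceeds all of \<open>W\<close>, so only arcs into
      \<open>t\<close> constrain its colour.\<close>
    let ?P = "{s \<in> insert t W. s < t \<and> R s t}"
    have "card (col ` ?P) \<le> n"
      using card_image_le[of ?P col] insert.prems[of t] insert.hyps by simp
    then have "\<not> {..n} \<subseteq> col ` ?P"
      using card_mono[of "col ` ?P" "{..n}"] insert.hyps by auto
    then obtain k where k: "k \<le> n" "k \<notin> col ` ?P"
      by auto
    have "\<forall>s\<in>insert t W. \<forall>t'\<in>insert t W. s < t' \<and> R s t' \<longrightarrow> (col(t := k)) s \<noteq> (col(t := k)) t'"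
    proof (intro ballI impI)
      fix s t' assume st: "s \<in> insert t W" "t' \<in> insert t W" "s < t' \<and> R s t'"
      have "s \<noteq> t" "s \<in> W"
        using st insert.hyps by force+
      then show "(col(t := k)) s \<noteq> (col(t := k)) t'"
        using col(2) k(2) st by (cases "t' = t") auto
    qed
    moreover have "(col(t := k)) ` insert t W \<subseteq> {..n}"
      using col(1) k(1) by auto
    ultimately show ?case
      by blast
  qed
  then obtain col where col: "col ` W \<subseteq> {..n}"
      "\<And>s t. s \<in> W \<Longrightarrow> t \<in> W \<Longrightarrow> s < t \<Longrightarrow> R s t \<Longrightarrow> col s \<noteq> (col t :: nat)"
    by blast
  have "card W = (\<Sum>k\<le>n. card {s \<in> W. col s = k})"
    using col(1) \<open>finite W\<close> by (subst card_eq_sum, subst sum.group[symmetric, of _ "{..n}" col]) auto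
  have "\<exists>k\<le>n. card W \<le> Suc n * card {s \<in> W. col s = k}"
  proof (rule ccontr)
    assume "\<not> ?thesis"
    then have "(\<Sum>k\<le>n. Suc n * card {s \<in> W. col s = k}) < (\<Sum>k\<le>n. card W)"
      by (intro sum_strict_mono) auto
    then show False
      using \<open>card W = _\<close> by (simp add: sum.distrib flip: sum_distrib_left)
  qed
  then obtain k where "card W \<le> Suc n * card {s \<in> W. col s = k}"
    by blast
  moreover have "\<not> R s t" if "s \<in> {s \<in> W. col s = k}" "t \<in> {s \<in> W. col s = k}" "s < t" for s t
    using col(2)[of s t] that by auto
  ultimately show thesis
    by (intro that[of "{s \<in> W. col s = k}"]) auto
qed

text \<open>A Turan-type bound. Inside \<open>B\<close> the average in-degree equals the average
  out-degree, so some \<open>v\<close> has at most \<open>d\<close> in-neighbours as well as at most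
  \<open>d\<close> out-neighbours. Keep \<open>v\<close>, delete it together with these neighbours,
  and recurse.\<close>

lemma max_degree_independent:
  fixes B :: "nat set"
  assumes "finite B" and "\<And>q. q \<in> B \<Longrightarrow> card {b \<in> B. (q, b) \<in> E} \<le> d"
  shows "\<exists>I\<subseteq>B. (\<forall>u\<in>I. \<forall>v\<in>I. u \<noteq> v \<longrightarrow> (u, v) \<notin> E) \<and> card B \<le> (2 * d + 1) * card I"
  using assms
proof (induction "card B" arbitrary: B rule: less_induct)
  case less
  show ?case
  proof (cases "B = {}")
    case False
    have "(\<Sum>v\<in>B. card {q \<in> B. (q, v) \<in> E}) = (\<Sum>q\<in>B. card {b \<in> B. (q, b) \<in> E})"
      using sum.swap_restrict[OF less.prems(1) less.prems(1), of "\<lambda>_ _. 1::nat" "\<lambda>v q. (q, v) \<in> E"] by simp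
    also have "\<dots> \<le> card B * d"
      using sum_bounded_above[of B "\<lambda>q. card {b \<in> B. (q, b) \<in> E}" d] less.prems by simp
    finally have *: "(\<Sum>v\<in>B. card {q \<in> B. (q, v) \<in> E}) \<le> card B * d" .
    have "\<exists>v\<in>B. card {q \<in> B. (q, v) \<in> E} \<le> d"
    proof (rule ccontr)
      assume "\<not> ?thesis"
      then have "(\<Sum>v\<in>B. d) < (\<Sum>v\<in>B. card {q \<in> B. (q, v) \<in> E})"
        using False less.prems by (intro sum_strict_mono) auto
      with * show False by simp
    qed
    then obtain v where v: "v \<in> B" "card {q \<in> B. (q, v) \<in> E} \<le> d"
      by blast
    define X where "X = {v} \<union> {q \<in> B. (q, v) \<in> E} \<union> {b \<in> B. (v, b) \<in> E}"
    have "X \<subseteq> B"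
      using v by (auto simp: X_def)
    have "card X \<le> card {v} + card {q \<in> B. (q, v) \<in> E} + card {b \<in> B. (v, b) \<in> E}"
      unfolding X_def by (meson add_le_mono1 card_Un_le le_trans)
    then have X: "card X \<le> 2 * d + 1"
      using v less.prems(2)[of v] by simp
    have "card (B - X) < card B"
      using v \<open>finite B\<close> by (intro psubset_card_mono) (auto simp: X_def)
    moreover have "card {b \<in> B - X. (q, b) \<in> E} \<le> d" if "q \<in> B - X" for q
    proof -
      have "card {b \<in> B - X. (q, b) \<in> E} \<le> card {b \<in> B. (q, b) \<in> E}"
        using \<open>finite B\<close> by (intro card_mono) auto
      with less.prems(2)[of q] that show ?thesis by simp
    qed
    ultimately obtain I where I: "I \<subseteq> B - X" "\<forall>u\<in>I. \<forall>v\<in>I. u \<noteq> v \<longrightarrow> (u, v) \<notin> E"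
        "card (B - X) \<le> (2 * d + 1) * card I"
      using less.hyps[of "B - X"] less.prems(1) by blast
    have "v \<notin> I" "finite I"
      using I \<open>finite B\<close> by (auto simp: X_def intro: finite_subset)
    then have "card (insert v I) = Suc (card I)"
      by simp
    moreover have "card B = card X + card (B - X)"
      using \<open>X \<subseteq> B\<close> \<open>finite B\<close> by (metis card_Diff_subset card_mono finite_subset le_add_diff_inverse)
    ultimately have "card B \<le> (2 * d + 1) * card (insert v I)"
      using I(3) X by simp
    moreover have "\<forall>u\<in>insert v I. \<forall>w\<in>insert v I. u \<noteq> w \<longrightarrow> (u, w) \<notin> E"
      using I(1,2) by (auto simp: X_def)
    ultimately show ?thesis
      using I(1) v by (intro exI[of _ "insert v I"]) auto
  qed auto
qed

text \<open>Each of the \<open>q\<close> new terms is at least the last one,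
  \<open>1 / (b + q)\<close>. In the greedy count this pays for one block of size
  \<open>q\<close>.\<close>

lemma harm_add_ge: "harm (b + q) - harm b \<ge> (real q / real (b + q) :: real)"
proof -
  have "harm (b + q) = harm b + (\<Sum>k=Suc b..b + q. inverse (of_nat k) :: real)"
  proof -
    have "{1..b + q} = {1..b} \<union> {Suc b..b + q}" by auto
    then show ?thesis
      by (simp add: harm_def sum.union_disjoint)
  qed
  moreover have "(\<Sum>k=Suc b..b + q. inverse (of_nat k) :: real) \<ge> (\<Sum>k=Suc b..b + q. inverse (real (b + q)))"
    by (intro sum_mono) (auto intro!: le_imp_inverse_le)
  ultimately show ?thesis
    by (simp add: divide_inverse)
qed

lemma harm_le_ln: "n \<ge> 1 \<Longrightarrow> harm n \<le> 1 + ln (real n)"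
proof (induction n rule: nat_induct_at_least)
  case (Suc n)
  \<comment> \<open>That is, \<open>ln (n + 1) - ln n\<close> is at least the new harmonic term
    \<open>1 / (n + 1)\<close>.\<close>
  have "ln (real n / real (Suc n)) \<le> real n / real (Suc n) - 1"
    using Suc by (intro ln_le_minus_one) auto
  also have "\<dots> = - inverse (real (Suc n))"
    by (simp add: field_simps)
  finally show ?case
    using Suc by (simp add: harm_Suc ln_div)
qed (auto simp: harm_def)

text \<open>Charge \<open>1 / |Q t|\<close> to every element of \<open>Q t\<close>: in order of time, the remaining union shrinks to
  nothing, so the charges are dominated by a harmonic sum.\<close>

lemma greedy_cover_count:
  fixes W :: "nat set" and Q :: "nat \<Rightarrow> nat set" and \<kappa> :: real
  assumes "finite W" "\<kappa> \<ge> 0" "\<And>t. t \<in> W \<Longrightarrow> finite (Q t) \<and> Q t \<noteq> {}" "disjoint_family_on Q W"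
    and "\<And>t. t \<in> W \<Longrightarrow> real (card (\<Union>s\<in>{s \<in> W. t \<le> s}. Q s)) \<le> \<kappa> * card (Q t)"
  shows "real (card W) \<le> \<kappa> * harm (card (\<Union>t\<in>W. Q t))"
  using assms
proof (induction rule: finite_linorder_min_induct)
  case empty
  then show ?case by (simp add: harm_def)
next
  case (insert t W)
  \<comment> \<open>\<open>t\<close> precedes all of \<open>W\<close>: inserting it leaves the
    remaining union of every other round unchanged, and its own remaining union is the whole
    one.\<close>
  have "t \<notin> W" using insert.hyps by auto
  have eq: "{s \<in> insert t W. t' \<le> s} = {s \<in> W. t' \<le> s}" if "t' \<in> W" for t'
    using insert.hyps that by force
  have IH: "real (card W) \<le> \<kappa> * harm (card (\<Union>s\<in>W. Q s))"
  proof (rule insert.IH)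
    show "disjoint_family_on Q W"
      using insert.prems(3) by (auto simp: disjoint_family_on_def)
    show "real (card (\<Union>s\<in>{s \<in> W. t' \<le> s}. Q s)) \<le> \<kappa> * card (Q t')" if "t' \<in> W" for t'
      using insert.prems(4)[of t'] that eq by simp
  qed (use insert.prems in auto)
  let ?b = "card (\<Union>s\<in>W. Q s)" and ?q = "card (Q t)"
  have "Q t \<inter> (\<Union>s\<in>W. Q s) = {}"
    using insert.prems(3) \<open>t \<notin> W\<close> by (fastforce simp: disjoint_family_on_def)
  then have card: "card (\<Union>s\<in>insert t W. Q s) = ?b + ?q"
    using insert.prems(2) insert.hyps by (simp add: card_Un_disjoint add.commute)
  have "{s \<in> insert t W. t \<le> s} = insert t W"
    using insert.hyps by force
  then have "real (?b + ?q) \<le> \<kappa> * ?q"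
    using insert.prems(4)[of t] card by simp
  moreover have "?q > 0"
    using insert.prems(2)[of t] by (simp add: card_gt_0_iff)
  ultimately have "1 \<le> \<kappa> * (real ?q / real (?b + ?q))"
    by (simp add: field_simps)
  also have "\<dots> \<le> \<kappa> * (harm (?b + ?q) - harm ?b)"
    using insert.prems(1) by (intro mult_left_mono harm_add_ge)
  finally show ?case
    using IH card \<open>t \<notin> W\<close> insert.hyps by (simp add: algebra_simps)
qed

subsection \<open>Counting exploration rounds\<close>

text \<open>Abel summation: \<open>1 / Suc j\<close> is spread over the levels
  \<open>k \<ge> j\<close> with weights \<open>w k\<close>, so that only the level counts matter,
  and these add up to a harmonic sum.\<close>

lemma sum_inverse_Suc_le:
  fixes n :: "'a \<Rightarrow> nat" and X :: real
  assumes "finite R" and n: "\<And>t. t \<in> R \<Longrightarrow> n t \<le> m" and "X \<ge> 0"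
    and card: "\<And>k. real (card {t \<in> R. n t \<le> k}) \<le> Suc k * X"
  shows "(\<Sum>t\<in>R. 1 / real (Suc (n t))) \<le> X * harm (Suc m)"
proof -
  \<comment> \<open>By partial fractions this is \<open>1 / (k + 1) - 1 / (k + 2)\<close>, hence the
    telescoping.\<close>
  define w where "w k = 1 / (real (Suc k) * real (Suc (Suc k)))" for k
  have telescope: "1 / real (Suc j) = 1 / real (Suc m) + (\<Sum>k<m. of_bool (j \<le> k) * w k)" if "j \<le> m" for j m
    using that
  proof (induction m rule: dec_induct)
    case base
    have "(\<Sum>k<j. of_bool (j \<le> k) * w k) = 0" by (intro sum.neutral) auto
    then show ?case by simp
  next
    case (step m)
    have "w m = 1 / real (Suc m) - 1 / real (Suc (Suc m))"
      by (simp add: w_def field_simps)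
    with step show ?case by simp
  qed
  have "(\<Sum>t\<in>R. 1 / real (Suc (n t)))
      = (\<Sum>t\<in>R. 1 / real (Suc m) + (\<Sum>k<m. of_bool (n t \<le> k) * w k))"
    using n by (intro sum.cong telescope refl)
  also have "\<dots> = card R / real (Suc m) + (\<Sum>k<m. \<Sum>t\<in>R. of_bool (n t \<le> k) * w k)"
    by (simp add: sum.distrib sum.swap[of _ R])
  also have "\<dots> = card R / real (Suc m) + (\<Sum>k<m. card {t \<in> R. n t \<le> k} * w k)"
  proof -
    have "(\<Sum>t\<in>R. of_bool (n t \<le> k)) = real (card {t \<in> R. n t \<le> k})" for k
      using \<open>finite R\<close> by (simp add: of_bool_def Int_def flip: sum.inter_filter)
    then show ?thesis by (simp flip: sum_distrib_right)
  qed
  also have "\<dots> \<le> X + (\<Sum>k<m. X * inverse (real (Suc (Suc k))))"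
  proof (intro add_mono sum_mono)
    have "{t \<in> R. n t \<le> m} = R" using n by auto
    then show "card R / real (Suc m) \<le> X"
      using card[of m] by (simp add: divide_le_eq mult.commute)
    fix k
    have "real (card {t \<in> R. n t \<le> k}) * w k \<le> (Suc k * X) * w k"
      by (intro mult_right_mono card) (simp add: w_def)
    also have "\<dots> = X * inverse (real (Suc (Suc k)))"
      by (simp add: w_def field_simps del: of_nat_Suc)
    finally show "real (card {t \<in> R. n t \<le> k}) * w k \<le> X * inverse (real (Suc (Suc k)))" .
  qed
  also have "\<dots> = X * harm (Suc m)"
  proof -
    have "harm (Suc m) = 1 + (\<Sum>k<m. inverse (real (Suc (Suc k))))"
      by (induction m) (simp_all add: harm_Suc, simp add: harm_def)
    then show ?thesis by (simp add: sum_distrib_left distrib_left)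
  qed
  finally show ?thesis .
qed

section \<open>Choosing an arm among the least observed ones\<close>

definition low :: "nat set \<Rightarrow> (nat \<Rightarrow> nat) \<Rightarrow> nat set" where
  "low A N = {a \<in> A. N a = Min (N ` A)}"

text \<open>Such an arm observes itself, so playing one always raises a lowest count.\<close>

definition low_loops :: "nat rel \<Rightarrow> nat set \<Rightarrow> (nat \<Rightarrow> nat) \<Rightarrow> nat set" where
  "low_loops E A N = {a \<in> low A N. (a, a) \<in> E}"

text \<open>If no lowest-count arm has a self-loop, strong observability makes any other arm observe
  it, so exploring only requires playing an arm different from some lowest-count arm.\<close>

definition good_choice :: "nat rel \<Rightarrow> nat set \<Rightarrow> (nat \<Rightarrow> nat) \<Rightarrow> nat \<Rightarrow> bool" where
  "good_choice E A N p \<longleftrightarrow>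
     (if low_loops E A N = {} then p \<in> A \<and> (A = {p} \<or> (\<exists>a\<in>low A N. a \<noteq> p))
      else is_arg_max (\<lambda>q. card {b \<in> low_loops E A N. (q, b) \<in> E}) (\<lambda>q. q \<in> low_loops E A N) p)"

lemma low_nonempty:
  assumes "finite A" "A \<noteq> {}"
  shows "low A N \<noteq> {}"
proof -
  have "Min (N ` A) \<in> N ` A"
    using assms by (intro Min_in) auto
  then show ?thesis
    by (force simp: low_def)
qed

lemma good_choice_exists:
  assumes "finite A" "A \<noteq> {}"
  shows "\<exists>p. good_choice E A N p"
proof (cases "low_loops E A N = {}")
  case True
  obtain a where a: "a \<in> low A N"
    using low_nonempty[OF assms] by blast
  then have "a \<in> A" by (simp add: low_def)
  show ?thesis
  proof (cases "A = {a}")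
    case False
    then obtain p where "p \<in> A" "p \<noteq> a" using \<open>a \<in> A\<close> by blast
    then show ?thesis using a True unfolding good_choice_def by auto
  qed (use True in \<open>auto simp: good_choice_def\<close>)
next
  case False
  let ?f = "\<lambda>q. card {b \<in> low_loops E A N. (q, b) \<in> E}"
  have "finite (low_loops E A N)"
    using assms by (simp add: low_loops_def low_def)
  then have "finite (?f ` low_loops E A N)" "?f ` low_loops E A N \<noteq> {}"
    using False by auto
  from Max_in[OF this] Max_ge[OF this(1)]
  have "\<exists>p. is_arg_max ?f (\<lambda>q. q \<in> low_loops E A N) p"
    by (force simp: is_arg_max_linorder)
  then show ?thesis using False by (simp add: good_choice_def)
qed

lemma good_choice_mem: "good_choice E A N p \<Longrightarrow> p \<in> A"
  by (auto simp: good_choice_def is_arg_max_def low_loops_def low_def split: if_splits)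

section \<open>The graph parameters as upper bounds\<close>

lemma finite_acyclic_cards: "finite {card D |D. D \<subseteq> {1..K::nat} \<and> acyclic ((E \<inter> D \<times> D) - Id)}"
proof (rule finite_subset)
  show "{card D |D. D \<subseteq> {1..K} \<and> acyclic ((E \<inter> D \<times> D) - Id)} \<subseteq> card ` Pow {1..K}"
    by auto
  show "finite (card ` Pow {1..K})"
    by (intro finite_imageI) simp
qed

lemma card_le_mas_number:
  assumes "D \<subseteq> {1..K}" "acyclic ((E \<inter> D \<times> D) - Id)"
  shows "card D \<le> mas_number K E"
  unfolding mas_number_def using assms by (intro Max_ge finite_acyclic_cards) auto

lemma sum_card_le_beta_bar:
  assumes "\<And>c. c \<in> {1..M} \<Longrightarrow> independent_set K E (I c)" "disjoint_family_on I {1..M}"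
  shows "(\<Sum>c=1..M. card (I c)) \<le> beta_bar M K E"
  unfolding beta_bar_def
proof (rule Max_ge)
  let ?S = "{\<Sum>c = 1..M. card (I c) |I.
      (\<forall>c\<in>{1..M}. independent_set K E (I c)) \<and> disjoint_family_on I {1..M}}"
  have "?S \<subseteq> {..M * K}"
  proof
    fix x assume "x \<in> ?S"
    then obtain I where x: "x = (\<Sum>c=1..M. card (I c))" and "\<forall>c\<in>{1..M}. independent_set K E (I c)"
      by blast
    then have "card (I c) \<le> K" if "c \<in> {1..M}" for c
      using that card_mono[of "{1..K}" "I c"] by (auto simp: independent_set_def)
    then show "x \<in> {..M * K}"
      using sum_bounded_above[of "{1..M}" "\<lambda>c. card (I c)" K] x by simp
  qed
  then show "finite ?S"
    by (rule finite_subset) simp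
qed (use assms in blast)

lemma mas_number_ge_1: "K \<ge> 1 \<Longrightarrow> mas_number K E \<ge> 1"
  using card_le_mas_number[of "{1}" K E] by (auto intro!: acyclicI_order[where f = id])

lemma beta_bar_ge_1: "K \<ge> 1 \<Longrightarrow> M \<ge> 1 \<Longrightarrow> beta_bar M K E \<ge> 1"
  using sum_card_le_beta_bar[of M K E "\<lambda>c. if c = 1 then {1} else {}"]
  by (auto simp: independent_set_def disjoint_family_on_def if_distrib sum.delta cong: if_cong)

text \<open>In the factor 5, rounds whose lowest-count arms include a self-loop account for 3 and
  the other rounds for 2.\<close>

definition effort :: "nat \<Rightarrow> nat \<Rightarrow> nat rel \<Rightarrow> real" where
  "effort K M E = 5 * (1 + ln K) * min (beta_bar M K E) (mas_number K E)"

lemma effort_ge_1: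
  assumes "K \<ge> 1" "M \<ge> 1"
  shows "effort K M E \<ge> 1"
proof -
  have "real (min (beta_bar M K E) (mas_number K E)) \<ge> 1"
    using beta_bar_ge_1[OF assms] mas_number_ge_1[OF assms(1)] by simp
  moreover have "ln (real K) \<ge> 0" using assms by simp
  ultimately have "1 * 1 \<le> (5 * (1 + ln K)) * real (min (beta_bar M K E) (mas_number K E))"
    by (intro mult_mono) auto
  then show ?thesis by (simp add: effort_def)
qed

text \<open>The combinatorial shadow of a run: rewards enter only through the active sets
  \<open>A\<close>, which shrink along the rounds of one context. The counts \<open>N\<close> are
  shared by all contexts, as cross-learning permits.\<close>

locale exploration =
  fixes K M T :: nat and E :: "nat rel" and ctx p :: "nat \<Rightarrow> nat" and A :: "nat \<Rightarrow> nat set"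
    and N :: "nat \<Rightarrow> nat \<Rightarrow> nat" and n :: "nat \<Rightarrow> nat"
  assumes K: "K \<ge> 1" and M: "M \<ge> 1"
    and observable: "strongly_observable K E"
    and ctx: "\<And>t. t < T \<Longrightarrow> ctx t \<in> {1..M}"
    and arms: "\<And>t. t < T \<Longrightarrow> A t \<subseteq> {1..K}"
    and antimono: "\<And>s t. s \<le> t \<Longrightarrow> t < T \<Longrightarrow> ctx s = ctx t \<Longrightarrow> A t \<subseteq> A s"
    and chosen: "\<And>t. t < T \<Longrightarrow> good_choice E (A t) (N t) (p t)"
    and N_def: "\<And>t a. N t a = card {s. s < t \<and> (p s, a) \<in> E}"
    and n_def: "\<And>t. n t = Min (N t ` A t)"
begin

lemma p_mem: "t < T \<Longrightarrow> p t \<in> A t"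
  using chosen good_choice_mem by blast

lemma finite_A: "t < T \<Longrightarrow> finite (A t)"
  using arms finite_subset by blast

lemma n_le_N: "t < T \<Longrightarrow> a \<in> A t \<Longrightarrow> n t \<le> N t a"
  unfolding n_def using finite_A by simp

lemma n_le: "t < T \<Longrightarrow> n t \<le> t"
proof -
  assume t: "t < T"
  have "N t (p t) \<le> card {..<t}"
    unfolding N_def by (intro card_mono) auto
  then show ?thesis
    using n_le_N[OF t p_mem[OF t]] by simp
qed

lemma N_ge: "W \<subseteq> {s. s < t \<and> (p s, a) \<in> E} \<Longrightarrow> card W \<le> N t a"
  unfolding N_def by (intro card_mono) auto

lemma N_mono: "s \<le> t \<Longrightarrow> N s a \<le> N t a"
  by (rule order_trans[OF _ N_ge[of "{r. r < s \<and> (p r, a) \<in> E}"]]) (auto simp: N_def)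

section \<open>Rounds with bounded least count\<close>

definition L :: "nat \<Rightarrow> nat set" where
  "L t = low_loops E (A t) (N t)"

definition loop_rounds :: "nat set" where
  "loop_rounds = {t. t < T \<and> L t \<noteq> {}}"

text \<open>Rounds with a single active arm are left out: under concentration that arm is optimal
  and costs nothing.\<close>

definition other_rounds :: "nat set" where
  "other_rounds = {t. t < T \<and> L t = {} \<and> A t \<noteq> {p t}}"

lemma loop_roundsD:
  assumes "t \<in> loop_rounds"
  shows "t < T" "p t \<in> L t" "q \<in> L t \<Longrightarrow> card {b \<in> L t. (q, b) \<in> E} \<le> card {b \<in> L t. (p t, b) \<in> E}"
  using assms chosen[of t]
  by (auto simp: loop_rounds_def good_choice_def L_def is_arg_max_linorder)

lemma L_iff: "a \<in> L t \<longleftrightarrow> a \<in> A t \<and> N t a = n t \<and> (a, a) \<in> E"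
  by (auto simp: L_def low_loops_def low_def n_def)

text \<open>If \<open>p s \<rightarrow> p t\<close> for an earlier round \<open>s\<close>, then \<open>s\<close> contributes to the count of \<open>p t\<close>, so there are
  few such forward arcs.  Rounds without forward arcs play arms whose edges all point backwards.\<close>

lemma loop_rounds_mas:
  "card {t \<in> loop_rounds. n t \<le> k} \<le> Suc k * mas_number K E"
proof -
  let ?W = "{t \<in> loop_rounds. n t \<le> k}" and ?R = "\<lambda>s t. (p s, p t) \<in> E"
  have "card {s \<in> ?W. s < t \<and> ?R s t} \<le> k" if t: "t \<in> ?W" for t
  proof -
    have "card {s \<in> ?W. s < t \<and> ?R s t} \<le> N t (p t)"
      by (rule N_ge) auto
    also have "\<dots> \<le> k"
      using t loop_roundsD(2)[of t] by (simp add: L_iff)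
    finally show ?thesis .
  qed
  moreover have "finite ?W"
    by (simp add: loop_rounds_def)
  ultimately obtain I where I: "I \<subseteq> ?W" "card ?W \<le> Suc k * card I"
      "\<And>s t. s \<in> I \<Longrightarrow> t \<in> I \<Longrightarrow> s < t \<Longrightarrow> (p s, p t) \<notin> E"
    using forward_sparse_independent[of ?W ?R k] by blast
  have loop: "(p t, p t) \<in> E" if "t \<in> I" for t
    using that I(1) loop_roundsD(2)[of t] by (auto simp: L_iff)
  \<comment> \<open>A repeated arm would turn its own self-loop into a forward arc.\<close>
  have inj: "inj_on p I"
    by (rule linorder_inj_onI') (metis I(3) loop)
  have "p ` I \<subseteq> {1..K}"
  proof (rule image_subsetI)
    fix t assume "t \<in> I"
    then have "t < T" using I(1) by (auto simp: loop_rounds_def)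
    then show "p t \<in> {1..K}" using arms p_mem by blast
  qed
  moreover have "acyclic ((E \<inter> p ` I \<times> p ` I) - Id)"
  proof (rule acyclicI_order[where f = "inv_into I p"])
    fix a b assume "(a, b) \<in> (E \<inter> p ` I \<times> p ` I) - Id"
    then obtain s t where "s \<in> I" "t \<in> I" "a = p s" "b = p t" "s \<noteq> t" "(p s, p t) \<in> E"
      by auto
    then show "inv_into I p b < inv_into I p a"
      using I(3)[of s t] inj by (cases s t rule: linorder_cases) auto
  qed
  ultimately have "card (p ` I) \<le> mas_number K E"
    by (rule card_le_mas_number)
  then have "Suc k * card I \<le> Suc k * mas_number K E"
    using inj by (intro mult_le_mono2) (simp add: card_image)
  with I(2) show ?thesis by (rule order_trans)
qed

text \<open>An arm observed at count \<open>k\<close> leaves level \<open>k\<close>.  Since active sets and levels shrink within one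
  context, every arm of the context still to be observed at level \<open>k\<close> already lies in \<open>L t\<close>, so the
  maximality of the out-degree of \<open>p t\<close> applies to any subset of them.\<close>

lemma loop_rounds_ctx:
  assumes B: "B = (\<Union>t\<in>{t \<in> loop_rounds. n t = k \<and> ctx t = c}. {b \<in> L t. (p t, b) \<in> E})"
  shows "\<exists>I\<subseteq>B. independent_set K E I \<and>
           real (card {t \<in> loop_rounds. n t = k \<and> ctx t = c}) \<le> 3 * (1 + ln K) * card I"
proof -
  let ?W = "{t \<in> loop_rounds. n t = k \<and> ctx t = c}"
  define Q where "Q t = {b \<in> L t. (p t, b) \<in> E}" for t
  have B: "B = (\<Union>t\<in>?W. Q t)"
    using B by (simp add: Q_def)
  have LK: "L t \<subseteq> {1..K}" if "t \<in> loop_rounds" for t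
    using that arms[of t] by (auto simp: L_iff loop_rounds_def)
  then have BK: "B \<subseteq> {1..K}"
    unfolding B Q_def by blast
  then have "finite B" by (rule finite_subset) simp
  \<comment> \<open>One largest independent subset of \<open>B\<close> bounds the independent
    subsets of all the shrinking remainders at once.\<close>
  let ?P = "\<lambda>I. I \<subseteq> B \<and> independent_set K E I"
  have "\<exists>I. ?P I \<and> (\<forall>J. ?P J \<longrightarrow> card J \<le> card I)"
  proof (rule ex_has_greatest_nat)
    show "?P {}" by (simp add: independent_set_def)
    show "\<forall>J. ?P J \<longrightarrow> card J < Suc (card B)"
      using card_mono[OF \<open>finite B\<close>] by (simp add: less_Suc_eq_le)
  qed
  then obtain I where I: "I \<subseteq> B" "independent_set K E I"
      and max: "\<And>J. J \<subseteq> B \<Longrightarrow> independent_set K E J \<Longrightarrow> card J \<le> card I"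
    by blast
  have subL: "(\<Union>s\<in>{s \<in> ?W. t \<le> s}. Q s) \<subseteq> L t" if t: "t \<in> ?W" for t
  proof
    fix b assume "b \<in> (\<Union>s\<in>{s \<in> ?W. t \<le> s}. Q s)"
    then obtain s where s: "s \<in> ?W" "t \<le> s" "b \<in> Q s" by blast
    then have "b \<in> A s" "N s b = k" "(b, b) \<in> E" "s < T"
      by (auto simp: Q_def L_iff loop_rounds_def)
    moreover have "b \<in> A t"
      using antimono[of t s] s t \<open>s < T\<close> \<open>b \<in> A s\<close> by auto
    ultimately show "b \<in> L t"
      using n_le_N[of t b] N_mono[of t s b] s t by (auto simp: L_iff loop_rounds_def)
  qed
  have "real (card ?W) \<le> (3 * real (card I)) * harm (card (\<Union>t\<in>?W. Q t))"
  proof (rule greedy_cover_count)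
    show "finite ?W" by (simp add: loop_rounds_def)
    show "finite (Q t) \<and> Q t \<noteq> {}" if "t \<in> ?W" for t
    proof
      show "finite (Q t)"
        using LK[of t] that by (auto simp: Q_def intro: finite_subset)
      show "Q t \<noteq> {}"
        using loop_roundsD(2)[of t] that by (auto simp: Q_def L_iff)
    qed
    show "disjoint_family_on Q ?W"
    proof (unfold disjoint_family_on_def, intro ballI impI)
      have *: "Q s \<inter> Q t = {}" if st: "s \<in> ?W" "t \<in> ?W" "s < t" for s t
      proof (rule ccontr)
        assume "Q s \<inter> Q t \<noteq> {}"
        then obtain b where b: "b \<in> Q s" "b \<in> Q t" by blast
        then have "N s b = k" "N t b = k" "(p s, b) \<in> E"
          using st by (auto simp: Q_def L_iff)
        moreover have "N t b \<ge> card (insert s {r. r < s \<and> (p r, b) \<in> E})"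
          using st \<open>(p s, b) \<in> E\<close> by (intro N_ge) auto
        ultimately show False by (simp add: N_def)
      qed
      show "Q s \<inter> Q t = {}" if "s \<in> ?W" "t \<in> ?W" "s \<noteq> t" for s t
        using *[of s t] *[of t s] that by (cases s t rule: linorder_cases) auto
    qed
    show "real (card (\<Union>s\<in>{s \<in> ?W. t \<le> s}. Q s)) \<le> (3 * real (card I)) * card (Q t)" if t: "t \<in> ?W" for t
    proof -
      let ?B = "\<Union>s\<in>{s \<in> ?W. t \<le> s}. Q s"
      have fin: "finite (L t)" using LK[of t] t finite_subset by auto
      have "?B \<subseteq> B" unfolding B by blast
      have deg: "card {b \<in> ?B. (q, b) \<in> E} \<le> card (Q t)" if "q \<in> ?B" for q
      proof -
        have "card {b \<in> ?B. (q, b) \<in> E} \<le> card {b \<in> L t. (q, b) \<in> E}"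
          using subL[OF t] fin by (intro card_mono) auto
        also have "\<dots> \<le> card (Q t)"
          using subL[OF t] that t loop_roundsD(3)[of t q] by (auto simp: Q_def)
        finally show ?thesis .
      qed
      have "finite ?B" using \<open>?B \<subseteq> B\<close> \<open>finite B\<close> by (rule finite_subset)
      from max_degree_independent[OF this deg]
      obtain J where J: "J \<subseteq> ?B" "\<forall>u\<in>J. \<forall>v\<in>J. u \<noteq> v \<longrightarrow> (u, v) \<notin> E"
          "card ?B \<le> (2 * card (Q t) + 1) * card J"
        by blast
      have "card J \<le> card I"
      proof (rule max)
        show "J \<subseteq> B" using J(1) \<open>?B \<subseteq> B\<close> by (rule order_trans)
        then show "independent_set K E J"
          using J(2) BK by (auto simp: independent_set_def)
      qed
      \<comment> \<open>The self-loop puts \<open>p t\<close> into \<open>Q t\<close>, so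
        \<open>2 * card (Q t) + 1 \<le> 3 * card (Q t)\<close>; this is the origin of the constant
        3.\<close>
      moreover have "p t \<in> Q t" "finite (Q t)"
        using loop_roundsD(2)[of t] t fin by (auto simp: Q_def L_iff[of "p t"])
      then have "card (Q t) \<ge> 1"
        by (auto simp: Suc_le_eq card_gt_0_iff)
      ultimately have "(2 * card (Q t) + 1) * card J \<le> (3 * card (Q t)) * card I"
        by (intro mult_le_mono) auto
      then have "card ?B \<le> (3 * card (Q t)) * card I"
        using J(3) by linarith
      then have "real (card ?B) \<le> real ((3 * card (Q t)) * card I)"
        by (rule of_nat_mono)
      then show ?thesis
        by (simp only: of_nat_mult of_nat_numeral mult_ac)
    qed
  qed simp
  also have "\<dots> \<le> (3 * real (card I)) * (1 + ln K)"
  proof (intro mult_left_mono)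
    have "card B \<le> K" using card_mono[OF _ BK] by simp
    then have "harm (card B) \<le> (harm K :: real)"
      by (intro harm_mono)
    also have "\<dots> \<le> 1 + ln K" using K by (rule harm_le_ln)
    finally show "harm (card (\<Union>t\<in>?W. Q t)) \<le> 1 + ln (real K)" by (simp add: B)
  qed simp
  finally have "real (card ?W) \<le> 3 * (1 + ln K) * card I"
    by (simp add: mult_ac)
  with I show ?thesis by blast
qed

lemma loop_rounds_level_beta:
  "real (card {t \<in> loop_rounds. n t = k}) \<le> 3 * (1 + ln K) * beta_bar M K E"
proof -
  let ?W = "\<lambda>c. {t \<in> loop_rounds. n t = k \<and> ctx t = c}"
  let ?B = "\<lambda>c. \<Union>t\<in>?W c. {b \<in> L t. (p t, b) \<in> E}"
  have "\<forall>c. \<exists>I\<subseteq>?B c. independent_set K E I \<and> real (card (?W c)) \<le> 3 * (1 + ln K) * card I"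
    using loop_rounds_ctx[OF refl] by blast
  from choice[OF this] obtain I where I: "\<And>c. I c \<subseteq> ?B c" "\<And>c. independent_set K E (I c)"
      "\<And>c. real (card (?W c)) \<le> 3 * (1 + ln K) * card (I c)"
    by blast
  have *: "False" if st: "s \<in> ?W c" "t \<in> ?W d" "s < t" and b: "b \<in> L s" "(p s, b) \<in> E" "b \<in> L t" for s t c d b
  proof -
    have "N t b \<ge> card (insert s {r. r < s \<and> (p r, b) \<in> E})"
      using st b by (intro N_ge) auto
    then show False using st b by (simp add: L_iff N_def)
  qed
  have disj: "?B c \<inter> ?B d = {}" if "c \<noteq> d" for c d
  proof (rule ccontr)
    assume "?B c \<inter> ?B d \<noteq> {}"
    then obtain b s t where b: "s \<in> ?W c" "b \<in> L s" "(p s, b) \<in> E" "t \<in> ?W d" "b \<in> L t" "(p t, b) \<in> E"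
      by blast
    then have "s \<noteq> t" using that by blast
    then consider "s < t" | "t < s" by linarith
    then show False
    proof cases
      case 1
      from *[OF b(1,4) 1 b(2,3,5)] show ?thesis .
    next
      case 2
      from *[OF b(4,1) 2 b(5,6,2)] show ?thesis .
    qed
  qed
  have "I c \<inter> I d \<subseteq> {}" if "c \<noteq> d" for c d
    unfolding disj[OF that, symmetric] by (intro Int_mono I(1))
  then have "disjoint_family_on I {1..M}"
    unfolding disjoint_family_on_def by simp
  from sum_card_le_beta_bar[OF I(2) this] have le: "(\<Sum>c=1..M. card (I c)) \<le> beta_bar M K E" .
  have "{t \<in> loop_rounds. n t = k} = (\<Union>c\<in>{1..M}. ?W c)"
    using ctx by (auto simp: loop_rounds_def)
  then have "card {t \<in> loop_rounds. n t = k} \<le> (\<Sum>c=1..M. card (?W c))"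
    by (simp add: card_UN_le)
  then have "real (card {t \<in> loop_rounds. n t = k}) \<le> (\<Sum>c=1..M. real (card (?W c)))"
    by (simp flip: of_nat_sum)
  also have "\<dots> \<le> (\<Sum>c=1..M. 3 * (1 + ln K) * card (I c))"
    by (intro sum_mono I(3))
  also have "\<dots> = 3 * (1 + ln K) * real (\<Sum>c=1..M. card (I c))"
    by (simp add: sum_distrib_left)
  also have "\<dots> \<le> 3 * (1 + ln K) * beta_bar M K E"
    using le K by (intro mult_left_mono of_nat_mono) auto
  finally show ?thesis .
qed

lemma loop_rounds_beta:
  "real (card {t \<in> loop_rounds. n t \<le> k}) \<le> Suc k * (3 * (1 + ln K) * beta_bar M K E)"
proof -
  have "{t \<in> loop_rounds. n t \<le> k} = (\<Union>j\<in>{..k}. {t \<in> loop_rounds. n t = j})"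
    by auto
  then have "card {t \<in> loop_rounds. n t \<le> k} \<le> (\<Sum>j\<le>k. card {t \<in> loop_rounds. n t = j})"
    by (simp add: card_UN_le)
  then have "real (card {t \<in> loop_rounds. n t \<le> k}) \<le> (\<Sum>j\<le>k. real (card {t \<in> loop_rounds. n t = j}))"
    by (simp flip: of_nat_sum)
  also have "\<dots> \<le> (\<Sum>j\<le>k. 3 * (1 + ln K) * beta_bar M K E)"
    by (intro sum_mono loop_rounds_level_beta)
  finally show ?thesis by simp
qed

text \<open>A loopless arm is seen in every round that does not play it.  Compare the last round with
  the last round that plays the target of that round.\<close>

lemma other_rounds_count: "card {t \<in> other_rounds. n t \<le> k} \<le> 2 * Suc k"
proof (cases "{t \<in> other_rounds. n t \<le> k} = {}")
  case False
  let ?W = "{t \<in> other_rounds. n t \<le> k}"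
  \<comment> \<open>The target is a lowest-count arm other than the played one; it has no self-loop
    because \<open>L t\<close> is empty.\<close>
  have target: "\<exists>a\<in>{1..K}. a \<noteq> p t \<and> (a, a) \<notin> E \<and> N t a \<le> k" if "t \<in> ?W" for t
  proof -
    have t: "t < T" "low_loops E (A t) (N t) = {}" "A t \<noteq> {p t}"
      using that by (auto simp: other_rounds_def L_def)
    then obtain a where "a \<in> low (A t) (N t)" "a \<noteq> p t"
      using chosen[of t] by (auto simp: good_choice_def)
    then show ?thesis
      using t that arms[of t] by (auto simp: low_loops_def low_def n_def)
  qed
  have seen: "card X \<le> N t a"
    if "a \<in> {1..K}" "(a, a) \<notin> E" "X \<subseteq> ?W" "\<And>s. s \<in> X \<Longrightarrow> s < t \<and> p s \<noteq> a" for X t a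
  proof (rule N_ge)
    have "p s \<in> {1..K}" if "s \<in> ?W" for s
      using that arms p_mem by (force simp: other_rounds_def)
    then show "X \<subseteq> {s. s < t \<and> (p s, a) \<in> E}"
      using that observable unfolding strongly_observable_def by blast
  qed
  have fin: "finite ?W" by (simp add: other_rounds_def)
  define t where "t = Max ?W"
  have t: "t \<in> ?W" "\<And>s. s \<in> ?W \<Longrightarrow> s \<le> t"
    using fin False by (auto simp: t_def intro: Max_in simp del: mem_Collect_eq)
  obtain a where a: "a \<in> {1..K}" "(a, a) \<notin> E" "N t a \<le> k"
    using target[OF t(1)] by blast
  let ?X = "{s \<in> ?W. s < t \<and> p s \<noteq> a}" and ?Y = "{s \<in> ?W. s < t \<and> p s = a}"
  have X: "card ?X \<le> k"
    using seen[of a ?X t] a by fastforce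
  have Y: "card ?Y \<le> Suc k"
  proof (cases "?Y = {}")
    case False
    have "finite ?Y" using fin by simp
    define v where "v = Max ?Y"
    have v: "v \<in> ?Y" "\<And>s. s \<in> ?Y \<Longrightarrow> s \<le> v"
      using \<open>finite ?Y\<close> False by (auto simp: v_def intro: Max_in simp del: mem_Collect_eq)
    \<comment> \<open>The target \<open>b\<close> of \<open>v\<close> differs from
      \<open>p v = a\<close>, so every earlier round of \<open>?Y\<close>, which plays
      \<open>a\<close>, observes \<open>b\<close>.\<close>
    obtain b where b: "b \<in> {1..K}" "b \<noteq> p v" "(b, b) \<notin> E" "N v b \<le> k"
      using target[of v] v(1) by blast
    have "card (?Y - {v}) \<le> N v b"
    proof (rule seen)
      show "s < v \<and> p s \<noteq> b" if "s \<in> ?Y - {v}" for s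
        using that v(1) v(2)[of s] b(2) by auto
    qed (use b in auto)
    then show ?thesis
      using b(4) v(1) \<open>finite ?Y\<close> by (simp add: card_Diff_singleton)
  qed (metis card.empty zero_le)
  \<comment> \<open>With \<open>t\<close> itself the total is
    \<open>k + (k + 1) + 1 = 2 * Suc k\<close>.\<close>
  have "?W = insert t (?X \<union> ?Y)"
    using t by (auto simp: le_less)
  then have "card ?W = card (insert t (?X \<union> ?Y))"
    by (rule arg_cong)
  also have "\<dots> \<le> Suc (card (?X \<union> ?Y))"
    using fin by (intro card_insert_le_m1) auto
  also have "\<dots> \<le> Suc (card ?X + card ?Y)"
    by (simp add: card_Un_le)
  finally have *: "card ?W \<le> Suc (card ?X + card ?Y)" .
  have "w \<le> 2 * Suc k" if "w \<le> Suc (x + y)" "x \<le> k" "y \<le> Suc k" for w x y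
    using that by simp
  from this[OF * X Y] show ?thesis .
qed (metis card.empty zero_le)

lemma rounds_le_effort:
  "real (card {t. t < T \<and> A t \<noteq> {p t} \<and> n t \<le> k}) \<le> Suc k * effort K M E"
proof -
  let ?m = "real (min (beta_bar M K E) (mas_number K E))"
  have "{t. t < T \<and> A t \<noteq> {p t} \<and> n t \<le> k} \<subseteq> {t \<in> loop_rounds. n t \<le> k} \<union> {t \<in> other_rounds. n t \<le> k}"
    by (auto simp: loop_rounds_def other_rounds_def)
  then have "card {t. t < T \<and> A t \<noteq> {p t} \<and> n t \<le> k} \<le> card ({t \<in> loop_rounds. n t \<le> k} \<union> {t \<in> other_rounds. n t \<le> k})"
    by (intro card_mono) (auto simp: loop_rounds_def other_rounds_def)
  also have "\<dots> \<le> card {t \<in> loop_rounds. n t \<le> k} + card {t \<in> other_rounds. n t \<le> k}"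
    by (rule card_Un_le)
  finally have "real (card {t. t < T \<and> A t \<noteq> {p t} \<and> n t \<le> k})
      \<le> real (card {t \<in> loop_rounds. n t \<le> k}) + 2 * real (Suc k)"
    using other_rounds_count[of k] by linarith
  moreover have lnK: "ln (real K) \<ge> 0" using K by simp
  have "real (card {t \<in> loop_rounds. n t \<le> k}) \<le> Suc k * (3 * (1 + ln K) * ?m)"
  proof (cases "beta_bar M K E \<le> mas_number K E")
    case True
    then show ?thesis using loop_rounds_beta[of k] by simp
  next
    case False
    have "real (card {t \<in> loop_rounds. n t \<le> k}) \<le> real (Suc k * mas_number K E)"
      using loop_rounds_mas by (intro of_nat_mono)
    also have "\<dots> = Suc k * (1 * real (mas_number K E))"
      by (simp only: of_nat_mult mult_1)
    also have "\<dots> \<le> Suc k * (3 * (1 + ln K) * real (mas_number K E))"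
      using lnK by (intro mult_left_mono mult_right_mono) auto
    finally show ?thesis using False by simp
  qed
  \<comment> \<open>Since \<open>(1 + ln K) * ?m\<close> is at least 1, the rounds in
    \<open>other_rounds\<close> are absorbed into the constant.\<close>
  moreover have "?m \<ge> 1"
    using beta_bar_ge_1[OF K M] mas_number_ge_1[OF K] by simp
  then have "1 * 1 \<le> (1 + ln K) * ?m"
    using lnK by (intro mult_mono) auto
  then have "real (Suc k) * 2 \<le> real (Suc k) * (2 * ((1 + ln K) * ?m))"
    by (intro mult_left_mono) auto
  ultimately show ?thesis
    by (simp add: effort_def algebra_simps)
qed

text \<open>Cauchy-Schwarz over at most \<open>T\<close> rounds reduces the radii to the sum of
  \<open>1 / Suc (n t)\<close>, which the level counts bound by \<open>effort\<close> times a
  harmonic number.\<close>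

lemma sum_radius_le:
  fixes r :: real
  assumes T: "T \<ge> 1" and r: "r \<ge> 0"
  shows "(\<Sum>t\<in>{t. t < T \<and> A t \<noteq> {p t}}. sqrt (r / real (Suc (n t))))
    \<le> sqrt (r * T * effort K M E * (1 + ln T))"
proof -
  let ?R = "{t. t < T \<and> A t \<noteq> {p t}}"
  \<comment> \<open>A count in round \<open>t\<close> is at most \<open>t \<le> T - 1\<close>, so
    the harmonic number is that of \<open>T\<close>.\<close>
  have "(\<Sum>t\<in>?R. 1 / real (Suc (n t))) \<le> effort K M E * harm (Suc (T - 1))"
  proof (rule sum_inverse_Suc_le)
    show "n t \<le> T - 1" if "t \<in> ?R" for t
      using n_le[of t] that by auto
    show "real (card {t \<in> ?R. n t \<le> k}) \<le> Suc k * effort K M E" for k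
      using rounds_le_effort[of k] by simp
  qed (use effort_ge_1[OF K M, of E] in auto)
  also have "\<dots> \<le> effort K M E * (1 + ln T)"
    using harm_le_ln[OF T] effort_ge_1[OF K M, of E] T by (intro mult_left_mono) auto
  finally have *: "(\<Sum>t\<in>?R. 1 / real (Suc (n t))) \<le> effort K M E * (1 + ln T)" .
  have "(\<Sum>t\<in>?R. sqrt (r / real (Suc (n t))) * 1)\<^sup>2
      \<le> (\<Sum>t\<in>?R. (sqrt (r / real (Suc (n t))))\<^sup>2) * (\<Sum>t\<in>?R. 1\<^sup>2)"
    by (rule Cauchy_Schwarz_ineq_sum)
  also have "(\<Sum>t\<in>?R. (sqrt (r / real (Suc (n t))))\<^sup>2) = r * (\<Sum>t\<in>?R. 1 / real (Suc (n t)))"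
    using r by (simp add: sum_distrib_left)
  also have "r * (\<Sum>t\<in>?R. 1 / real (Suc (n t))) * (\<Sum>t\<in>?R. 1\<^sup>2) \<le> r * (effort K M E * (1 + ln T)) * T"
  proof (intro mult_mono mult_left_mono *)
    have "card ?R \<le> card {..<T}" by (intro card_mono) auto
    then show "(\<Sum>t\<in>?R. 1\<^sup>2) \<le> real T" by simp
  qed (use r T effort_ge_1[OF K M, of E] in \<open>auto intro!: mult_nonneg_nonneg sum_nonneg\<close>)
  finally have "(\<Sum>t\<in>?R. sqrt (r / real (Suc (n t))))\<^sup>2 \<le> r * T * effort K M E * (1 + ln T)"
    by (simp add: mult_ac)
  then show ?thesis by (rule real_le_rsqrt)
qed

end

subsection \<open>Concentration of predictably sampled sums\<close>

context prob_space
begin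

text \<open>Hoeffding's lemma for a range of length one, normalised to mean at most 1: the
  multiplicative step of the supermartingale below.\<close>

lemma expectation_exp_centered_le:
  fixes f :: "'a \<Rightarrow> real"
  assumes [measurable]: "random_variable borel f" and f: "AE \<omega> in M. f \<omega> \<in> {0..1}"
    and m: "expectation f = m" and l: "l > 0"
  shows "integrable M (\<lambda>\<omega>. exp (l * (f \<omega> - m) - l\<^sup>2 / 8))"
    and "expectation (\<lambda>\<omega>. exp (l * (f \<omega> - m) - l\<^sup>2 / 8)) \<le> 1"
proof -
  interpret interval_bounded_random_variable M f 0 1
    by unfold_locales (use f in auto)
  \<comment> \<open>Together with \<open>f \<omega> \<le> 1\<close> this bounds the exponent by
    \<open>l\<close>, which gives integrability.\<close>
  have m0: "m \<ge> 0"
    unfolding m[symmetric] by (rule integral_nonneg_AE) (use f in \<open>auto elim: eventually_mono\<close>)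
  have int: "integrable M (\<lambda>\<omega>. exp (l * (f \<omega> - m)))"
  proof (rule integrable_const_bound[where B = "exp l"])
    show "AE \<omega> in M. norm (exp (l * (f \<omega> - m))) \<le> exp l"
      using f
    proof eventually_elim
      case (elim \<omega>)
      then have "l * (f \<omega> - m) \<le> l * 1"
        using l m0 by (intro mult_left_mono) auto
      then show ?case by simp
    qed
  qed simp
  then show "integrable M (\<lambda>\<omega>. exp (l * (f \<omega> - m) - l\<^sup>2 / 8))"
    by (simp add: exp_diff)
  have "ennreal (expectation (\<lambda>\<omega>. exp (l * (f \<omega> - m)))) \<le> ennreal (exp (l\<^sup>2 / 8))"
    using Hoeffdings_lemma_nn_integral[OF l] int m by (subst nn_integral_eq_integral[symmetric]) auto
  then have "expectation (\<lambda>\<omega>. exp (l * (f \<omega> - m))) \<le> exp (l\<^sup>2 / 8)"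
    by (subst (asm) ennreal_le_iff) auto
  then show "expectation (\<lambda>\<omega>. exp (l * (f \<omega> - m) - l\<^sup>2 / 8)) \<le> 1"
    by (simp add: exp_diff divide_le_eq)
qed

end

text \<open>The exponential supermartingale of the centred sum over the predictably sampled indices.\<close>

definition tilt ::
  "(nat \<Rightarrow> (nat \<Rightarrow> 'b) \<Rightarrow> bool) \<Rightarrow> ('b \<Rightarrow> real) \<Rightarrow> real \<Rightarrow> real \<Rightarrow> nat \<Rightarrow> (nat \<Rightarrow> 'b) \<Rightarrow> real" where
  "tilt D g m l t x =
     (\<Prod>s<t. if D s (restrict x {..<s}) then exp (l * (g (x s) - m) - l\<^sup>2 / 8) else 1)"

text \<open>Makes the product up to \<open>t\<close> a function of the first \<open>t\<close>
  coordinates, hence independent of the next one.\<close>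

lemma tilt_restrict: "tilt D g m l t (restrict x {..<t}) = tilt D g m l t x"
proof -
  have "restrict (restrict x {..<t}) {..<s} = restrict x {..<s}" if "s < t" for s
    using that by (auto simp: restrict_def fun_eq_iff)
  then show ?thesis
    unfolding tilt_def by (intro prod.cong) auto
qed

lemma tilt_measurable:
  assumes [measurable]: "g \<in> borel_measurable S"
    and D: "\<And>s. s < t \<Longrightarrow> Measurable.pred (PiM {..<s} (\<lambda>_. S)) (D s)"
  shows "tilt D g m l t \<in> borel_measurable (PiM {..<t} (\<lambda>_. S))"
  unfolding tilt_def
proof (rule borel_measurable_prod)
  fix s assume s: "s \<in> {..<t}"
  have [measurable]: "Measurable.pred (PiM {..<t} (\<lambda>_. S)) (\<lambda>x. D s (restrict x {..<s}))"
    by (rule measurable_compose[OF measurable_restrict_subset D]) (use s in auto)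
  have [measurable]: "(\<lambda>x. x s) \<in> measurable (PiM {..<t} (\<lambda>_. S)) S"
    using s by (intro measurable_component_singleton)
  show "(\<lambda>x. if D s (restrict x {..<s}) then exp (l * (g (x s) - m) - l\<^sup>2 / 8) else 1)
      \<in> borel_measurable (PiM {..<t} (\<lambda>_. S))"
    by measurable
qed

lemma tilt_eq_exp:
  "tilt D g m l t x = exp (l * (\<Sum>s\<in>{s \<in> {..<t}. D s (restrict x {..<s})}. g (x s) - m)
      - l\<^sup>2 / 8 * card {s \<in> {..<t}. D s (restrict x {..<s})})"
proof -
  have "tilt D g m l t x = (\<Prod>s\<in>{s \<in> {..<t}. D s (restrict x {..<s})}. exp (l * (g (x s) - m) - l\<^sup>2 / 8))"
    unfolding tilt_def by (subst prod.inter_filter) simp_all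
  also have "\<dots> = exp (\<Sum>s\<in>{s \<in> {..<t}. D s (restrict x {..<s})}. l * (g (x s) - m) - l\<^sup>2 / 8)"
    by (simp add: exp_sum)
  finally show ?thesis
    unfolding sum_subtractf[of "\<lambda>s. l * (g (x s) - m)"] sum_distrib_left by (simp add: mult.commute)
qed

text \<open>\<open>D s\<close> reads only the values before \<open>s\<close>: the decision to sample
  \<open>X s\<close> is predictable and therefore independent of \<open>X s\<close>. The laws of the
  \<open>X s\<close> may differ.\<close>

locale sampled_sequence = prob_space M for M :: "'a measure" +
  fixes S :: "'b measure" and X :: "nat \<Rightarrow> 'a \<Rightarrow> 'b" and T :: nat
    and D :: "nat \<Rightarrow> (nat \<Rightarrow> 'b) \<Rightarrow> bool"
  assumes indep: "indep_vars (\<lambda>_. S) X {..<T}"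
    and D: "\<And>s. s < T \<Longrightarrow> Measurable.pred (PiM {..<s} (\<lambda>_. S)) (D s)"
begin

text \<open>Input only: for the coordinate process \<open>X t \<omega> = \<omega> t\<close> the abbreviation eta-contracts to a bare
  variable, and printing with it would not terminate.\<close>

abbreviation (input) seq :: "'a \<Rightarrow> nat \<Rightarrow> 'b" where
  "seq \<omega> \<equiv> \<lambda>s. X s \<omega>"

abbreviation (input) sampled :: "nat \<Rightarrow> 'a \<Rightarrow> nat set" where
  "sampled t \<omega> \<equiv> {s \<in> {..<t}. D s (restrict (seq \<omega>) {..<s})}"

lemma X_measurable: "s < T \<Longrightarrow> X s \<in> measurable M S"
  using indep by (auto simp: indep_vars_def)

lemma restrict_measurable:
  "t \<le> T \<Longrightarrow> (\<lambda>\<omega>. restrict (seq \<omega>) {..<t}) \<in> measurable M (PiM {..<t} (\<lambda>_. S))"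
  by (intro measurable_restrict X_measurable) auto

lemma tilt_measurable_seq:
  assumes "t \<le> T" "g \<in> borel_measurable S"
  shows "(\<lambda>\<omega>. tilt D g m l t (seq \<omega>)) \<in> borel_measurable M"
proof -
  have "(\<lambda>\<omega>. tilt D g m l t (restrict (seq \<omega>) {..<t})) \<in> borel_measurable M"
    using assms D by (intro measurable_compose[OF restrict_measurable tilt_measurable]) auto
  then show ?thesis by (simp add: tilt_restrict)
qed

text \<open>Split step \<open>t\<close> by whether it is sampled. If not, the product is unchanged;
  if so, the new factor is independent of the past and has mean at most 1.\<close>

lemma tilt_integrable_expectation:
  assumes g: "g \<in> borel_measurable S" "\<And>s. s < T \<Longrightarrow> AE \<omega> in M. g (X s \<omega>) \<in> {0..1}"
    and m: "\<And>s. s < T \<Longrightarrow> expectation (\<lambda>\<omega>. g (X s \<omega>)) = m"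
    and l: "l > 0" and t: "t \<le> T"
  shows "integrable M (\<lambda>\<omega>. tilt D g m l t (seq \<omega>)) \<and> expectation (\<lambda>\<omega>. tilt D g m l t (seq \<omega>)) \<le> 1"
  using t
proof (induction t)
  case 0
  then show ?case by (simp add: tilt_def prob_space)
next
  case (Suc t)
  then have t: "t < T" by simp
  let ?F = "\<lambda>\<omega>. tilt D g m l t (seq \<omega>)"
  define B where "B \<omega> \<longleftrightarrow> D t (restrict (seq \<omega>) {..<t})" for \<omega>
  define e where "e \<omega> = exp (l * (g (X t \<omega>) - m) - l\<^sup>2 / 8)" for \<omega>
  have F: "integrable M ?F" "expectation ?F \<le> 1"
    using Suc by auto
  have [measurable]: "Measurable.pred M B"
    unfolding B_def using t by (intro measurable_compose[OF restrict_measurable D]) auto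
  have [measurable]: "(\<lambda>\<omega>. g (X t \<omega>)) \<in> borel_measurable M"
    using X_measurable[OF t] g(1) by (rule measurable_compose)
  have e: "integrable M e" "expectation e \<le> 1"
    unfolding e_def using expectation_exp_centered_le[OF _ g(2)[OF t] m[OF t] l] by auto
  have FB: "integrable M (\<lambda>\<omega>. ?F \<omega> * of_bool (B \<omega>))" "integrable M (\<lambda>\<omega>. ?F \<omega> * of_bool (\<not> B \<omega>))"
    by (rule Bochner_Integration.integrable_bound[OF F(1)]; use F(1) in \<open>auto intro!: borel_measurable_times\<close>)+
  have nonneg: "0 \<le> expectation (\<lambda>\<omega>. ?F \<omega> * of_bool (B \<omega>))"
    by (rule Bochner_Integration.integral_nonneg) (auto simp: tilt_def intro!: prod_nonneg mult_nonneg_nonneg)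
  \<comment> \<open>The two variables are functions of the disjoint coordinate blocks
    \<open>{..<t}\<close> and \<open>{t}\<close>.\<close>
  have ind: "indep_var borel (\<lambda>\<omega>. ?F \<omega> * of_bool (B \<omega>)) borel e"
  proof -
    have "(\<lambda>x. x t) \<in> measurable (PiM {t} (\<lambda>_. S)) S"
      by (intro measurable_component_singleton) simp
    then have [measurable]: "(\<lambda>x. g (x t)) \<in> borel_measurable (PiM {t} (\<lambda>_. S))"
      using g(1) by (rule measurable_compose)
    have [measurable]: "tilt D g m l t \<in> borel_measurable (PiM {..<t} (\<lambda>_. S))"
      using g D t by (intro tilt_measurable) auto
    have [measurable]: "Measurable.pred (PiM {..<t} (\<lambda>_. S)) (D t)"
      using D t by simp
    have "indep_var borel ((\<lambda>x. tilt D g m l t x * of_bool (D t x)) \<circ> (\<lambda>\<omega>. restrict (seq \<omega>) {..<t}))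
        borel ((\<lambda>x. exp (l * (g (x t) - m) - l\<^sup>2 / 8)) \<circ> (\<lambda>\<omega>. restrict (seq \<omega>) {t}))"
      using t by (intro indep_var_compose[OF indep_var_restrict[OF indep]]) auto
    then show ?thesis
      by (simp add: comp_def tilt_restrict B_def e_def[abs_def])
  qed
  have eq: "tilt D g m l (Suc t) (seq \<omega>) = ?F \<omega> * of_bool (B \<omega>) * e \<omega> + ?F \<omega> * of_bool (\<not> B \<omega>)" for \<omega>
    by (simp add: tilt_def B_def e_def)
  have int: "integrable M (\<lambda>\<omega>. ?F \<omega> * of_bool (B \<omega>) * e \<omega>)"
    by (rule indep_var_integrable[OF ind FB(1) e(1)])
  have "expectation (\<lambda>\<omega>. tilt D g m l (Suc t) (seq \<omega>))
      = expectation (\<lambda>\<omega>. ?F \<omega> * of_bool (B \<omega>)) * expectation e + expectation (\<lambda>\<omega>. ?F \<omega> * of_bool (\<not> B \<omega>))"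
    unfolding eq using int FB by (simp add: indep_var_lebesgue_integral[OF ind FB(1) e(1)])
  also have "\<dots> \<le> expectation (\<lambda>\<omega>. ?F \<omega> * of_bool (B \<omega>)) * 1 + expectation (\<lambda>\<omega>. ?F \<omega> * of_bool (\<not> B \<omega>))"
    using nonneg e(2) by (intro add_mono mult_left_mono) auto
  also have "\<dots> = expectation (\<lambda>\<omega>. ?F \<omega> * of_bool (B \<omega>) + ?F \<omega> * of_bool (\<not> B \<omega>))"
    using FB by simp
  also have "(\<lambda>\<omega>. ?F \<omega> * of_bool (B \<omega>) + ?F \<omega> * of_bool (\<not> B \<omega>)) = ?F"
    by auto
  finally show ?case
    using F(2) int FB(2) unfolding eq by simp
qed

lemma sampled_measurable: "t \<le> T \<Longrightarrow> (\<lambda>\<omega>. card (sampled t \<omega>)) \<in> measurable M (count_space UNIV)"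
proof -
  assume t: "t \<le> T"
  have [measurable]: "Measurable.pred M (\<lambda>\<omega>. D s (restrict (seq \<omega>) {..<s}))" if "s < t" for s
    using t that by (intro measurable_compose[OF restrict_measurable D]) auto
  have "card (sampled t \<omega>) = (\<Sum>s<t. if D s (restrict (seq \<omega>) {..<s}) then 1 else 0)" for \<omega>
    by (simp add: sum.inter_filter[symmetric])
  moreover have "(\<lambda>\<omega>. \<Sum>s<t. if D s (restrict (seq \<omega>) {..<s}) then 1 else 0 :: nat) \<in> measurable M (count_space UNIV)"
    by (intro measurable_sum_nat) auto
  ultimately show ?thesis by simp
qed

lemma sampled_sum_measurable:
  fixes g :: "'b \<Rightarrow> real"
  assumes t: "t \<le> T" and g: "g \<in> borel_measurable S"
  shows "(\<lambda>\<omega>. \<Sum>s\<in>sampled t \<omega>. g (X s \<omega>) - m) \<in> borel_measurable M"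
proof -
  have "Measurable.pred M (\<lambda>\<omega>. D s (restrict (seq \<omega>) {..<s}))"
    "(\<lambda>\<omega>. g (X s \<omega>)) \<in> borel_measurable M" if "s < t" for s
    using t that g by (auto intro!: measurable_compose[OF restrict_measurable D] measurable_compose[OF X_measurable])
  then have "(\<lambda>\<omega>. if D s (restrict (seq \<omega>) {..<s}) then g (X s \<omega>) - m else 0) \<in> borel_measurable M" if "s < t" for s
    using that by (intro measurable_If borel_measurable_diff) (auto simp: pred_def)
  then have "(\<lambda>\<omega>. \<Sum>s<t. if D s (restrict (seq \<omega>) {..<s}) then g (X s \<omega>) - m else 0) \<in> borel_measurable M"
    by (intro borel_measurable_sum) simp
  then show ?thesis by (subst sum.inter_filter) simp_all
qed

text \<open>Markov's inequality for \<open>tilt\<close>. Fixing the random sample size at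
  \<open>n\<close> makes the quadratic term of the exponent a constant.\<close>

lemma sampled_sum_upper_tail:
  assumes g: "g \<in> borel_measurable S" "\<And>s. s < T \<Longrightarrow> AE \<omega> in M. g (X s \<omega>) \<in> {0..1}"
    and m: "\<And>s. s < T \<Longrightarrow> expectation (\<lambda>\<omega>. g (X s \<omega>)) = m"
    and t: "t \<le> T" and n: "n \<ge> 1" and x: "x > 0"
  shows "prob {\<omega> \<in> space M. card (sampled t \<omega>) = n \<and> (\<Sum>s\<in>sampled t \<omega>. g (X s \<omega>) - m) \<ge> x}
           \<le> exp (- 2 * x\<^sup>2 / n)"
proof -
  \<comment> \<open>The maximiser of \<open>l * x - l\<^sup>2 / 8 * n\<close>.\<close>
  define l where "l = 4 * x / n"
  have l: "l > 0" using x n by (simp add: l_def)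
  have exponent: "l * x - l\<^sup>2 / 8 * n = 2 * x\<^sup>2 / n"
    using n by (simp add: l_def field_simps power2_eq_square)
  let ?F = "\<lambda>\<omega>. tilt D g m l t (seq \<omega>)"
  have F: "integrable M ?F" "expectation ?F \<le> 1"
    using tilt_integrable_expectation[OF g m l t] by auto
  note [measurable] = tilt_measurable_seq[OF t g(1)]
  have "prob {\<omega> \<in> space M. card (sampled t \<omega>) = n \<and> (\<Sum>s\<in>sampled t \<omega>. g (X s \<omega>) - m) \<ge> x}
      \<le> prob {\<omega> \<in> space M. ?F \<omega> \<ge> exp (2 * x\<^sup>2 / n)}"
  proof (rule finite_measure_mono)
    show "{\<omega> \<in> space M. card (sampled t \<omega>) = n \<and> (\<Sum>s\<in>sampled t \<omega>. g (X s \<omega>) - m) \<ge> x}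
        \<subseteq> {\<omega> \<in> space M. ?F \<omega> \<ge> exp (2 * x\<^sup>2 / n)}"
      using l by (auto simp: tilt_eq_exp simp flip: exponent)
  qed measurable
  also have "\<dots> \<le> expectation ?F / exp (2 * x\<^sup>2 / n)"
    using F(1) by (intro integral_Markov_inequality_measure[where A = "{}"])
      (auto simp: tilt_def intro!: prod_nonneg)
  also have "\<dots> \<le> 1 / exp (2 * x\<^sup>2 / n)"
    using F(2) by (intro divide_right_mono) auto
  finally show ?thesis
    by (simp add: exp_minus field_simps)
qed

text \<open>The lower tail of \<open>g\<close> is the upper tail of \<open>1 - g\<close>, which is
  again bounded by 0 and 1.\<close>

lemma sampled_sum_tail:
  assumes g: "g \<in> borel_measurable S" "\<And>s. s < T \<Longrightarrow> AE \<omega> in M. g (X s \<omega>) \<in> {0..1}"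
    and m: "\<And>s. s < T \<Longrightarrow> expectation (\<lambda>\<omega>. g (X s \<omega>)) = m"
    and t: "t \<le> T" and n: "n \<ge> 1" and x: "x > 0"
  shows "prob {\<omega> \<in> space M. card (sampled t \<omega>) = n \<and> \<bar>\<Sum>s\<in>sampled t \<omega>. g (X s \<omega>) - m\<bar> \<ge> x}
           \<le> 2 * exp (- 2 * x\<^sup>2 / n)"
proof -
  let ?g = "\<lambda>y. 1 - g y"
  have g': "?g \<in> borel_measurable S" using g(1) by simp
  define c where "c \<omega> = card (sampled t \<omega>)" for \<omega>
  define u where "u \<omega> = (\<Sum>s\<in>sampled t \<omega>. g (X s \<omega>) - m)" for \<omega>
  define v where "v \<omega> = (\<Sum>s\<in>sampled t \<omega>. ?g (X s \<omega>) - (1 - m))" for \<omega>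
  have [measurable]: "c \<in> measurable M (count_space UNIV)" "u \<in> borel_measurable M" "v \<in> borel_measurable M"
    unfolding c_def u_def v_def
    by (rule sampled_measurable[OF t], rule sampled_sum_measurable[OF t g(1)], rule sampled_sum_measurable[OF t g'])
  have v: "v \<omega> = - u \<omega>" for \<omega>
    unfolding u_def v_def sum_negf[symmetric] by (intro sum.cong) auto
  have int: "integrable M (\<lambda>\<omega>. g (X s \<omega>))" if "s < T" for s
  proof (rule integrable_const_bound[where B = 1])
    show "AE \<omega> in M. norm (g (X s \<omega>)) \<le> 1"
      using g(2)[OF that] by eventually_elim auto
    show "(\<lambda>\<omega>. g (X s \<omega>)) \<in> borel_measurable M"
      using X_measurable[OF that] g(1) by (rule measurable_compose)
  qed
  have "prob {\<omega> \<in> space M. c \<omega> = n \<and> \<bar>u \<omega>\<bar> \<ge> x}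
      \<le> prob ({\<omega> \<in> space M. c \<omega> = n \<and> u \<omega> \<ge> x} \<union> {\<omega> \<in> space M. c \<omega> = n \<and> v \<omega> \<ge> x})"
    by (intro finite_measure_mono) (auto simp: v)
  also have "\<dots> \<le> prob {\<omega> \<in> space M. c \<omega> = n \<and> u \<omega> \<ge> x} + prob {\<omega> \<in> space M. c \<omega> = n \<and> v \<omega> \<ge> x}"
    by (intro measure_Un_le) auto
  also have "prob {\<omega> \<in> space M. c \<omega> = n \<and> v \<omega> \<ge> x} \<le> exp (- 2 * x\<^sup>2 / n)"
    unfolding c_def v_def
  proof (rule sampled_sum_upper_tail[OF g' _ _ t n x])
    show "AE \<omega> in M. ?g (X s \<omega>) \<in> {0..1}" if "s < T" for s
      using g(2)[OF that] by eventually_elim auto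
    show "expectation (\<lambda>\<omega>. ?g (X s \<omega>)) = 1 - m" if "s < T" for s
      using int[OF that] m[OF that] by (simp add: prob_space)
  qed
  also have "prob {\<omega> \<in> space M. c \<omega> = n \<and> u \<omega> \<ge> x} \<le> exp (- 2 * x\<^sup>2 / n)"
    unfolding c_def u_def by (rule sampled_sum_upper_tail[OF g m t n x])
  finally show ?thesis
    by (simp add: c_def u_def)
qed

end

subsection \<open>The elimination policy\<close>

text \<open>A round counts whatever its context was, because every observation reveals the rewards
  of all contexts.\<close>

definition sees :: "nat rel \<Rightarrow> nat list \<Rightarrow> nat \<Rightarrow> nat set" where
  "sees E as a = {s \<in> {..<length as}. (as ! s, a) \<in> E}"

definition cnt :: "nat rel \<Rightarrow> nat list \<Rightarrow> nat \<Rightarrow> nat" where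
  "cnt E as a = card (sees E as a)"

definition est :: "nat rel \<Rightarrow> nat list \<Rightarrow> reward_table \<Rightarrow> nat \<Rightarrow> nat \<Rightarrow> real" where
  "est E as h c a = (\<Sum>s\<in>sees E as a. h s (c, a)) / real (cnt E as a)"

text \<open>An arm never observed has estimate \<open>0 / 0 = 0\<close>; the shift \<open>Suc k\<close> keeps the radius at least \<open>1\<close> in
  that case (for \<open>r \<ge> 1\<close>), so that the confidence interval remains valid.\<close>

definition rad :: "real \<Rightarrow> nat \<Rightarrow> real" where
  "rad r k = sqrt (r / real (Suc k))"

text \<open>Testing the intervals at all past times makes elimination permanent, although the policy
  keeps no state and recomputes the set from the history.\<close>

definition active :: "nat \<Rightarrow> nat rel \<Rightarrow> real \<Rightarrow> nat \<Rightarrow> nat list \<Rightarrow> reward_table \<Rightarrow> nat set" where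
  "active K E r c as h = {a \<in> {1..K}. \<forall>t\<in>{..length as}. \<forall>b\<in>{1..K}.
     est E (take t as) h c b - rad r (cnt E (take t as) b)
       \<le> est E (take t as) h c a + rad r (cnt E (take t as) a)}"

text \<open>An empty active set occurs only when the concentration event fails.\<close>

definition pick :: "nat rel \<Rightarrow> nat set \<Rightarrow> (nat \<Rightarrow> nat) \<Rightarrow> nat" where
  "pick E A N = (if A = {} then 1 else SOME p. good_choice E A N p)"

definition elim_choice :: "nat \<Rightarrow> nat rel \<Rightarrow> real \<Rightarrow> nat list \<Rightarrow> nat list \<Rightarrow> reward_table \<Rightarrow> nat" where
  "elim_choice K E r cs as h = pick E (active K E r (last cs) as h) (cnt E as)"

definition elim_policy :: "nat \<Rightarrow> nat rel \<Rightarrow> real \<Rightarrow> bandit_policy" where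
  "elim_policy K E r cs as h = return_pmf (elim_choice K E r cs as h)"

text \<open>The trajectory as a function of the whole reward table, without the blanking of
  \<open>observed\<close>; \<open>play_elim_policy\<close> shows that the policy follows it.\<close>

primrec acts :: "nat \<Rightarrow> nat rel \<Rightarrow> real \<Rightarrow> nat list \<Rightarrow> reward_table \<Rightarrow> nat \<Rightarrow> nat list" where
  "acts K E r cs h 0 = []"
| "acts K E r cs h (Suc t) =
     acts K E r cs h t @ [elim_choice K E r (take (Suc t) cs) (acts K E r cs h t) h]"

lemma good_choice_pick: "finite A \<Longrightarrow> A \<noteq> {} \<Longrightarrow> good_choice E A N (pick E A N)"
  using someI_ex[OF good_choice_exists] by (simp add: pick_def)

lemma active_subset: "active K E r c as h \<subseteq> {1..K}"
  by (auto simp: active_def)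

lemma elim_choice_mem: "K \<ge> 1 \<Longrightarrow> elim_choice K E r cs as h \<in> {1..K}"
  using active_subset[of K E r "last cs" as h] finite_subset[OF active_subset]
    good_choice_mem[OF good_choice_pick, of "active K E r (last cs) as h" E "cnt E as"]
  by (cases "active K E r (last cs) as h = {}") (auto simp: elim_choice_def pick_def)

lemma length_acts [simp]: "length (acts K E r cs h t) = t"
  by (induction t) auto

lemma take_acts: "s \<le> t \<Longrightarrow> take s (acts K E r cs h t) = acts K E r cs h s"
  by (induction t rule: dec_induct) (auto simp: take_Suc)

lemma nth_acts:
  assumes "s < t"
  shows "acts K E r cs h t ! s = elim_choice K E r (take (Suc s) cs) (acts K E r cs h s) h"
proof -
  have "acts K E r cs h t ! s = take (Suc s) (acts K E r cs h t) ! s"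
    by simp
  also have "\<dots> = acts K E r cs h (Suc s) ! s"
    using assms by (simp only: take_acts Suc_le_eq)
  finally show ?thesis by (simp add: nth_append)
qed

lemma sees_take: "sees E (take t as) a = {s \<in> sees E as a. s < t}"
  by (auto simp: sees_def)

text \<open>Only revealed entries enter the estimates. Hence neither blanking hidden entries nor
  cutting off the future changes a decision.\<close>

lemma active_cong:
  assumes "\<And>s b. s < length as \<Longrightarrow> b \<in> {1..K} \<Longrightarrow> (as ! s, b) \<in> E \<Longrightarrow> h s (c, b) = h' s (c, b)"
  shows "active K E r c as h = active K E r c as h'"
proof -
  have "est E (take t as) h c b = est E (take t as) h' c b" if "b \<in> {1..K}" for t b
    unfolding est_def using assms that
    by (intro arg_cong2[where f = "(/)"] sum.cong refl) (auto simp: sees_take sees_def)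
  then show ?thesis
    unfolding active_def by (intro Collect_cong conj_cong ball_cong refl) auto
qed

lemma elim_choice_observed:
  "last cs \<in> {1..M} \<Longrightarrow> elim_choice K E r cs as (observed K M E as h) = elim_choice K E r cs as h"
  unfolding elim_choice_def
  by (intro arg_cong[of _ _ "\<lambda>A. pick E A _"] active_cong) (auto simp: observed_def)

lemma acts_restrict: "t \<le> n \<Longrightarrow> acts K E r cs (restrict h {..<n}) t = acts K E r cs h t"
proof (induction t)
  case (Suc t)
  have "active K E r c (acts K E r cs h t) (restrict h {..<n}) = active K E r c (acts K E r cs h t) h" for c
    using Suc.prems by (intro active_cong) auto
  then show ?case using Suc by (simp add: elim_choice_def del: restrict_apply)
qed simp

lemma last_take_context:
  assumes "cs \<in> context_seqs M T" "t < T"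
  shows "last (take (Suc t) cs) = cs ! t" "cs ! t \<in> {1..M}"
  using assms by (auto simp: context_seqs_def take_Suc_conv_app_nth) (use nth_mem in fastforce)+

lemma play_elim_policy:
  assumes "cs \<in> context_seqs M T" "t \<le> T"
  shows "play K M E (elim_policy K E r) cs h t = return_pmf (acts K E r cs h t)"
  using assms(2)
proof (induction t)
  case (Suc t)
  then have "last (take (Suc t) cs) \<in> {1..M}"
    using last_take_context[OF assms(1)] by simp
  with Suc show ?case
    by (simp add: bind_return_pmf elim_policy_def elim_choice_observed)
qed simp

section \<open>Measurability of the policy\<close>

lemma est_measurable:
  assumes "length as \<le> n" "c \<in> {1..M}" "a \<in> {1..K}"
  shows "(\<lambda>h. est E as h c a) \<in> borel_measurable (table_space K M n)"
  unfolding est_def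
proof (intro borel_measurable_divide borel_measurable_sum borel_measurable_const)
  fix s assume "s \<in> sees E as a"
  then have "s \<in> {..<n}" using assms by (auto simp: sees_def)
  then have "(\<lambda>h. h s) \<in> measurable (table_space K M n) (reward_space K M)"
    by (rule measurable_component_singleton)
  moreover have "(\<lambda>y. y (c, a)) \<in> borel_measurable (reward_space K M)"
    using assms by (intro measurable_component_singleton) auto
  ultimately show "(\<lambda>h. h s (c, a)) \<in> borel_measurable (table_space K M n)"
    by (rule measurable_compose)
qed

text \<open>The range is finite, and each fibre is cut out by finitely many comparisons of
  estimates. Passing through this discrete space makes the choice measurable whatever
  \<open>SOME\<close> in \<open>pick\<close> selects.\<close>

lemma active_measurable:
  assumes "length as \<le> n" "c \<in> {1..M}"
  shows "(\<lambda>h. active K E r c as h) \<in> measurable (table_space K M n) (count_space (Pow {1..K}))"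
proof (subst measurable_count_space_eq2, simp, intro conjI ballI)
  show "(\<lambda>h. active K E r c as h) \<in> space (table_space K M n) \<rightarrow> Pow {1..K}"
    using active_subset by blast
  fix B assume B: "B \<in> Pow {1..K}"
  have est: "(\<lambda>h. est E (take t as) h c a) \<in> borel_measurable (table_space K M n)"
    if "a \<in> {1..K}" for t a
    using assms that by (intro est_measurable) auto
  have "Measurable.pred (table_space K M n) (\<lambda>h. a \<in> active K E r c as h)" if a: "a \<in> {1..K}" for a
  proof -
    have "Measurable.pred (table_space K M n) (\<lambda>h.
        est E (take t as) h c b - rad r (cnt E (take t as) b)
          \<le> est E (take t as) h c a + rad r (cnt E (take t as) a))" if "b \<in> {1..K}" for t b
      unfolding pred_def
      by (intro borel_measurable_le borel_measurable_diff borel_measurable_add borel_measurable_const est a that)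
    then have "Measurable.pred (table_space K M n) (\<lambda>h. \<forall>t\<in>{..length as}. \<forall>b\<in>{1..K}.
        est E (take t as) h c b - rad r (cnt E (take t as) b)
          \<le> est E (take t as) h c a + rad r (cnt E (take t as) a))"
      by (intro pred_intros_finite) auto
    then show ?thesis using a by (simp add: active_def)
  qed
  then have "Measurable.pred (table_space K M n) (\<lambda>h. \<forall>a\<in>{1..K}. (a \<in> active K E r c as h) = (a \<in> B))"
    by (intro pred_intros_finite pred_intros_logic) auto
  moreover have "active K E r c as h = B \<longleftrightarrow> (\<forall>a\<in>{1..K}. (a \<in> active K E r c as h) = (a \<in> B))" for h
    using B active_subset[of K E r c as h] by (auto simp only: Pow_iff)
  then have "(\<lambda>h. active K E r c as h) -` {B} \<inter> space (table_space K M n)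
      = {h \<in> space (table_space K M n). \<forall>a\<in>{1..K}. (a \<in> active K E r c as h) = (a \<in> B)}"
    unfolding vimage_def by (simp add: Int_def conj_commute)
  ultimately show "(\<lambda>h. active K E r c as h) -` {B} \<inter> space (table_space K M n) \<in> sets (table_space K M n)"
    by (simp only: pred_def)
qed

lemma elim_choice_measurable:
  assumes "length as \<le> n" "last cs \<in> {1..M}"
  shows "(\<lambda>h. elim_choice K E r cs as h) \<in> measurable (table_space K M n) (count_space UNIV)"
  unfolding elim_choice_def
  by (rule measurable_compose[OF active_measurable[OF assms]]) simp

lemma valid_elim_policy:
  assumes "K \<ge> 1"
  shows "valid_policy K M T (elim_policy K E r)"
  unfolding valid_policy_def
proof (intro allI impI ballI conjI, goal_cases)
  case (1 t cs as h)
  then show ?case using elim_choice_mem[OF assms] by (simp add: elim_policy_def)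
next
  case (2 t cs as a)
  then have "last cs \<in> {1..M}"
    by (auto simp: context_seqs_def) (metis Zero_not_Suc atLeastAtMost_iff last_in_set list.size(3) subset_iff)+
  then have "(\<lambda>h. elim_choice K E r cs as h) \<in> measurable (table_space K M t) (count_space UNIV)"
    using 2 by (intro elim_choice_measurable) auto
  from measurable_compose[OF this, of "indicat_real {a}" borel]
  show ?case by (simp add: elim_policy_def)
qed

text \<open>There are countably many action histories, so each step reduces to a fixed
  history.\<close>

lemma acts_measurable:
  assumes cs: "cs \<in> context_seqs M T" and "t \<le> T" "t \<le> n"
  shows "(\<lambda>h. acts K E r cs h t) \<in> measurable (table_space K M n) (count_space {as. length as = t})"
  using assms(2,3)
proof (induction t)
  case (Suc t)
  have "(\<lambda>h. as @ [elim_choice K E r (take (Suc t) cs) as h])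
      \<in> measurable (table_space K M n) (count_space {as. length as = Suc t})" if "as \<in> {as. length as = t}" for as
  proof (rule measurable_compose[OF elim_choice_measurable[of as n "take (Suc t) cs"]])
    show "length as \<le> n" using that Suc by simp
    show "last (take (Suc t) cs) \<in> {1..M}"
      using last_take_context[OF cs, of t] Suc by simp
  qed (use that in auto)
  moreover have "(\<lambda>h. acts K E r cs h t) \<in> measurable (table_space K M n) (count_space {as. length as = t})"
    using Suc by simp
  ultimately show ?case
    unfolding acts.simps by (rule measurable_compose_countable'[where I = "{as. length as = t}"]) auto
qed simp

subsection \<open>Regret of the elimination policy\<close>

lemma environment_space:
  assumes "environment K M T \<mu> P"
  shows "space P = space (table_space K M T)"
proof (rule sets_eq_imp_space_eq)
  show "sets P = sets (table_space K M T)"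
    using assms unfolding environment_def by blast
qed

locale elimination_run =
  fixes K M T :: nat and E :: "nat rel" and r :: real and cs :: "nat list" and \<mu> :: "nat \<Rightarrow> nat \<Rightarrow> real"
  assumes K: "K \<ge> 1" and M: "M \<ge> 1" and T: "T \<ge> 1"
    and observable: "strongly_observable K E"
    and cs: "cs \<in> context_seqs M T"
    and r: "r \<ge> 1"
    and \<mu>: "\<And>c a. c \<in> {1..M} \<Longrightarrow> a \<in> {1..K} \<Longrightarrow> \<mu> c a \<in> {0..1}"
begin

abbreviation run :: "reward_table \<Rightarrow> nat \<Rightarrow> nat list" where
  "run \<equiv> acts K E r cs"

definition concentrated :: "reward_table \<Rightarrow> bool" where
  "concentrated \<omega> \<longleftrightarrow> (\<forall>t<T. \<forall>c\<in>{1..M}. \<forall>a\<in>{1..K}.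
     \<bar>est E (run \<omega> t) \<omega> c a - \<mu> c a\<bar> \<le> rad r (cnt E (run \<omega> t) a))"

lemma context_mem: "t < T \<Longrightarrow> cs ! t \<in> {1..M}"
  using last_take_context[OF cs] by blast

lemma length_cs: "length cs = T"
  using cs by (simp add: context_seqs_def)

lemma active_run:
  "active K E r c (run \<omega> t) \<omega> = {a \<in> {1..K}. \<forall>s\<in>{..t}. \<forall>b\<in>{1..K}.
     est E (run \<omega> s) \<omega> c b - rad r (cnt E (run \<omega> s) b)
       \<le> est E (run \<omega> s) \<omega> c a + rad r (cnt E (run \<omega> s) a)}"
  by (auto simp: active_def take_acts)

text \<open>The upper end of the interval of an optimal arm lies above its mean, hence above all
  other means and their lower ends.\<close>

lemma optimal_active:
  assumes good: "concentrated \<omega>" and t: "t < T" and c: "c \<in> {1..M}" and a: "a \<in> {1..K}"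
    and opt: "\<And>b. b \<in> {1..K} \<Longrightarrow> \<mu> c b \<le> \<mu> c a"
  shows "a \<in> active K E r c (run \<omega> t) \<omega>"
proof -
  have "est E (run \<omega> s) \<omega> c b - rad r (cnt E (run \<omega> s) b)
      \<le> est E (run \<omega> s) \<omega> c a + rad r (cnt E (run \<omega> s) a)" if "s \<le> t" "b \<in> {1..K}" for s b
  proof -
    have "\<bar>est E (run \<omega> s) \<omega> c b - \<mu> c b\<bar> \<le> rad r (cnt E (run \<omega> s) b)"
      "\<bar>est E (run \<omega> s) \<omega> c a - \<mu> c a\<bar> \<le> rad r (cnt E (run \<omega> s) a)"
      using good t c a that unfolding concentrated_def by auto
    then show ?thesis
      using opt[OF that(2)] by linarith
  qed
  then show ?thesis
    using a by (simp add: active_run)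
qed

text \<open>Overlap of the two intervals costs one radius per arm, and passing from estimates to
  means another one per arm.\<close>

lemma active_gap:
  assumes good: "concentrated \<omega>" and t: "t < T" and c: "c \<in> {1..M}"
    and a: "a \<in> active K E r c (run \<omega> t) \<omega>" and b: "b \<in> active K E r c (run \<omega> t) \<omega>"
    and k: "k \<le> cnt E (run \<omega> t) a" "k \<le> cnt E (run \<omega> t) b"
  shows "\<mu> c b - \<mu> c a \<le> 4 * rad r k"
proof -
  have K: "a \<in> {1..K}" "b \<in> {1..K}"
    using a b active_subset by blast+
  have "est E (run \<omega> t) \<omega> c b - rad r (cnt E (run \<omega> t) b)
      \<le> est E (run \<omega> t) \<omega> c a + rad r (cnt E (run \<omega> t) a)"
    using a K unfolding active_run by auto
  moreover have "\<bar>est E (run \<omega> t) \<omega> c b - \<mu> c b\<bar> \<le> rad r (cnt E (run \<omega> t) b)"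
      "\<bar>est E (run \<omega> t) \<omega> c a - \<mu> c a\<bar> \<le> rad r (cnt E (run \<omega> t) a)"
    using good t c K unfolding concentrated_def by auto
  moreover have "rad r j \<le> rad r k" if "k \<le> j" for j
    using that r by (simp add: rad_def frac_le)
  from this[OF k(1)] this[OF k(2)] have "rad r (cnt E (run \<omega> t) a) \<le> rad r k"
    "rad r (cnt E (run \<omega> t) b) \<le> rad r k" .
  ultimately show ?thesis by linarith
qed

definition regret_bound :: real where
  "regret_bound = 4 * sqrt (r * T * effort K M E * (1 + ln T))"

lemma optimal_arm: obtains a where "a \<in> {1..K}" "(MAX b\<in>{1..K}. \<mu> c b) = \<mu> c a"
  "\<And>b. b \<in> {1..K} \<Longrightarrow> \<mu> c b \<le> \<mu> c a"
proof -
  have "(MAX b\<in>{1..K}. \<mu> c b) \<in> (\<lambda>b. \<mu> c b) ` {1..K}"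
    using K by (intro Max_in) auto
  then obtain a where a: "a \<in> {1..K}" "(MAX b\<in>{1..K}. \<mu> c b) = \<mu> c a" by blast
  have "\<mu> c b \<le> \<mu> c a" if "b \<in> {1..K}" for b
    unfolding a(2)[symmetric] using that by (intro Max_ge) auto
  with a show thesis by (rule that)
qed

text \<open>Concentration enters through \<open>optimal_active\<close>: an optimal arm keeps the
  active set nonempty, so \<open>pick\<close> makes a good choice.\<close>

lemma exploration_run:
  assumes good: "concentrated \<omega>"
  shows "exploration K M T E (\<lambda>t. cs ! t) (\<lambda>t. run \<omega> (Suc t) ! t)
    (\<lambda>t. active K E r (cs ! t) (run \<omega> t) \<omega>) (\<lambda>t. cnt E (run \<omega> t))
    (\<lambda>t. Min (cnt E (run \<omega> t) ` active K E r (cs ! t) (run \<omega> t) \<omega>))"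
proof unfold_locales
  show "active K E r (cs ! t) (run \<omega> t) \<omega> \<subseteq> active K E r (cs ! s) (run \<omega> s) \<omega>"
    if "s \<le> t" "cs ! s = cs ! t" for s t
    unfolding active_run that(2) using that(1) by (intro Collect_mono) auto
  show "good_choice E (active K E r (cs ! t) (run \<omega> t) \<omega>) (cnt E (run \<omega> t)) (run \<omega> (Suc t) ! t)"
    if t: "t < T" for t
  proof -
    obtain a where "a \<in> {1..K}" "\<And>b. b \<in> {1..K} \<Longrightarrow> \<mu> (cs ! t) b \<le> \<mu> (cs ! t) a"
      using optimal_arm by metis
    then have "a \<in> active K E r (cs ! t) (run \<omega> t) \<omega>"
      using optimal_active[OF good t] context_mem[OF t] by blast
    moreover have "run \<omega> (Suc t) ! t = pick E (active K E r (cs ! t) (run \<omega> t) \<omega>) (cnt E (run \<omega> t))"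
      using last_take_context(1)[OF cs t] by (simp add: nth_append elim_choice_def)
    ultimately show ?thesis
      using finite_subset[OF active_subset] by (auto intro!: good_choice_pick)
  qed
  show "cnt E (run \<omega> t) a = card {s. s < t \<and> (run \<omega> (Suc s) ! s, a) \<in> E}" for t a
    unfolding cnt_def sees_def
    by (intro arg_cong[of _ _ card] Collect_cong) (auto simp: nth_acts nth_append)
qed (use K M observable context_mem active_subset in auto)

lemma pseudo_regret_good:
  assumes good: "concentrated \<omega>"
  shows "pseudo_regret K \<mu> cs (run \<omega> T) \<le> regret_bound"
proof -
  let ?A = "\<lambda>t. active K E r (cs ! t) (run \<omega> t) \<omega>" and ?p = "\<lambda>t. run \<omega> (Suc t) ! t"
  let ?n = "\<lambda>t. Min (cnt E (run \<omega> t) ` ?A t)"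
  interpret exploration K M T E "\<lambda>t. cs ! t" ?p ?A "\<lambda>t. cnt E (run \<omega> t)" ?n
    using good by (rule exploration_run)
  let ?R = "{t. t < T \<and> ?A t \<noteq> {?p t}}"
  \<comment> \<open>A sole active arm is optimal, because an optimal arm is active. Otherwise both
    arms have at least the least count and \<open>active_gap\<close> applies.\<close>
  have gap: "(MAX a\<in>{1..K}. \<mu> (cs ! t) a) - \<mu> (cs ! t) (run \<omega> T ! t)
      \<le> (if ?A t \<noteq> {?p t} then 4 * rad r (?n t) else 0)" if t: "t < T" for t
  proof -
    obtain a where a: "a \<in> {1..K}" "(MAX b\<in>{1..K}. \<mu> (cs ! t) b) = \<mu> (cs ! t) a"
      "\<And>b. b \<in> {1..K} \<Longrightarrow> \<mu> (cs ! t) b \<le> \<mu> (cs ! t) a"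
      using optimal_arm by metis
    have "a \<in> ?A t"
      using optimal_active[OF good t context_mem[OF t] a(1,3)] by blast
    moreover have "run \<omega> T ! t = ?p t"
      using t by (simp only: nth_acts lessI)
    ultimately show ?thesis
      using a(2) active_gap[OF good t context_mem[OF t] p_mem[OF t] \<open>a \<in> ?A t\<close> n_le_N[OF t p_mem[OF t]]
        n_le_N[OF t \<open>a \<in> ?A t\<close>]]
      by (simp del: acts.simps) (metis order_refl singletonD)
  qed
  have "pseudo_regret K \<mu> cs (run \<omega> T) \<le> (\<Sum>t<T. if ?A t \<noteq> {?p t} then 4 * rad r (?n t) else 0)"
    unfolding pseudo_regret_def length_cs by (intro sum_mono gap) simp
  also have "\<dots> = 4 * (\<Sum>t\<in>?R. sqrt (r / real (Suc (?n t))))"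
  proof -
    have "{t \<in> {..<T}. ?A t \<noteq> {?p t}} = ?R" by auto
    then show ?thesis
      by (subst sum.inter_filter[symmetric]) (simp_all only: finite_lessThan rad_def sum_distrib_left)
  qed
  also have "\<dots> \<le> regret_bound"
    unfolding regret_bound_def using sum_radius_le[OF T, of r] r by simp
  finally show ?thesis .
qed

lemma pseudo_regret_le: "pseudo_regret K \<mu> cs (run \<omega> T) \<le> T"
proof -
  have "(MAX a\<in>{1..K}. \<mu> (cs ! t) a) - \<mu> (cs ! t) (run \<omega> T ! t) \<le> 1" if t: "t < T" for t
  proof -
    obtain a where "a \<in> {1..K}" "(MAX b\<in>{1..K}. \<mu> (cs ! t) b) = \<mu> (cs ! t) a"
      using optimal_arm by metis
    moreover have "run \<omega> T ! t \<in> {1..K}"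
      using t elim_choice_mem[OF K] by (simp only: nth_acts)
    ultimately show ?thesis
      using \<mu>[OF context_mem[OF t], of a] \<mu>[OF context_mem[OF t], of "run \<omega> T ! t"] by auto
  qed
  then have "pseudo_regret K \<mu> cs (run \<omega> T) \<le> (\<Sum>t<T. 1)"
    unfolding pseudo_regret_def length_cs by (intro sum_mono) simp
  then show ?thesis by simp
qed

lemma regret_bound_nonneg: "regret_bound \<ge> 0"
  using effort_ge_1[OF K M, of E] r T unfolding regret_bound_def by simp

text \<open>The threshold \<open>x = sqrt (n * r / 2)\<close> makes \<open>2 * x^2 / n\<close> equal
  to \<open>r\<close>. The count \<open>n\<close> is a parameter because the tail bound holds at a
  fixed sample size.\<close>

definition deviation :: "nat \<Rightarrow> nat \<Rightarrow> nat \<Rightarrow> nat \<Rightarrow> reward_table set" where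
  "deviation t n c a = {\<omega> \<in> space (table_space K M T). card (sees E (run \<omega> t) a) = n \<and>
     \<bar>\<Sum>s\<in>sees E (run \<omega> t) a. \<omega> s (c, a) - \<mu> c a\<bar> \<ge> sqrt (n * r / 2)}"

definition deviations :: "reward_table set" where
  "deviations = (\<Union>(t, n, c, a)\<in>{..<T} \<times> {1..T} \<times> {1..M} \<times> {1..K}. deviation t n c a)"

lemma concentrated_or_deviation:
  assumes \<omega>: "\<omega> \<in> space (table_space K M T)" and "\<omega> \<notin> deviations"
  shows "concentrated \<omega>"
  unfolding concentrated_def
proof (intro allI impI ballI)
  fix t c a assume t: "t < T" and c: "c \<in> {1..M}" and a: "a \<in> {1..K}"
  let ?n = "cnt E (run \<omega> t) a" and ?S = "\<Sum>s\<in>sees E (run \<omega> t) a. \<omega> s (c, a) - \<mu> c a"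
  show "\<bar>est E (run \<omega> t) \<omega> c a - \<mu> c a\<bar> \<le> rad r ?n"
  proof (cases "?n = 0")
    case True
    have "\<bar>\<mu> c a\<bar> \<le> 1" "1 \<le> sqrt r"
      using \<mu>[OF c a] r by auto
    then have "\<bar>\<mu> c a\<bar> \<le> sqrt r" by linarith
    then show ?thesis
      unfolding est_def rad_def True by simp
  next
    case False
    have "?n \<le> card {..<t}"
      unfolding cnt_def sees_def by (intro card_mono) auto
    then have "?n \<in> {1..T}" using False t by simp
    then have "\<omega> \<notin> deviation t ?n c a"
      using assms(2) t c a unfolding deviations_def by blast
    then have S: "\<bar>?S\<bar> < sqrt (?n * r / 2)"
      using \<omega> by (simp add: deviation_def cnt_def)
    have "est E (run \<omega> t) \<omega> c a - \<mu> c a = ?S / ?n"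
      using False by (simp add: est_def sum_subtractf cnt_def field_simps)
    then have "\<bar>est E (run \<omega> t) \<omega> c a - \<mu> c a\<bar> \<le> sqrt (?n * r / 2) / ?n"
      using S by (simp add: divide_right_mono)
    also have "\<dots> = sqrt (?n * r / 2 / (real ?n)\<^sup>2)"
      by (simp only: real_sqrt_divide[of "?n * r / 2"] real_sqrt_abs abs_of_nat)
    also have "\<dots> \<le> rad r ?n"
      unfolding rad_def
    proof (rule real_sqrt_le_mono)
      \<comment> \<open>As \<open>Suc ?n \<le> 2 * ?n\<close> for a positive count, the factor 2 in
        the threshold pays for the shift in \<open>rad\<close>.\<close>
      have "?n * r / 2 / (real ?n)\<^sup>2 = r / (2 * real ?n)"
        using False by (simp add: power2_eq_square)
      also have "\<dots> \<le> r / real (Suc ?n)"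
        using False r by (intro divide_left_mono) auto
      finally show "?n * r / 2 / (real ?n)\<^sup>2 \<le> r / real (Suc ?n)" .
    qed
    finally show ?thesis .
  qed
qed

text \<open>The action of round \<open>s\<close>, hence whether it reveals \<open>a\<close>, is
  computed from the rewards before \<open>s\<close>.\<close>

lemma sampled_run:
  assumes env: "environment K M T \<mu> P"
  shows "sampled_sequence P (reward_space K M) (\<lambda>t \<omega>. \<omega> t) T
    (\<lambda>s h. (elim_choice K E r (take (Suc s) cs) (run h s) h, a) \<in> E)"
proof -
  interpret prob_space P
    using env by (simp add: environment_def)
  have "Measurable.pred (table_space K M s) (\<lambda>h. (elim_choice K E r (take (Suc s) cs) (run h s) h, a) \<in> E)"
    if s: "s < T" for s
  proof -
    have "(\<lambda>h. run h s) \<in> measurable (table_space K M s) (count_space {as. length as = s})"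
      using s by (intro acts_measurable[OF cs]) auto
    moreover have "(\<lambda>h. elim_choice K E r (take (Suc s) cs) as h) \<in> measurable (table_space K M s) (count_space UNIV)"
      if "as \<in> {as. length as = s}" for as
      using that s last_take_context[OF cs s] by (intro elim_choice_measurable) auto
    ultimately have "(\<lambda>h. elim_choice K E r (take (Suc s) cs) (run h s) h) \<in> measurable (table_space K M s) (count_space UNIV)"
      by (intro measurable_compose_countable'[where I = "{as. length as = s}" and g = "\<lambda>h. run h s"
            and f = "\<lambda>as h. elim_choice K E r (take (Suc s) cs) as h"]) auto
    then show ?thesis
      by (rule measurable_compose) simp
  qed
  then show ?thesis
    using env by unfold_locales (auto simp: environment_def)
qed

lemma choice_restrict:
  assumes "s < t"
  shows "elim_choice K E r (take (Suc s) cs) (run (restrict \<omega> {..<s}) s) (restrict \<omega> {..<s}) = run \<omega> t ! s"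
proof -
  have "active K E r (last (take (Suc s) cs)) (run \<omega> s) (restrict \<omega> {..<s})
      = active K E r (last (take (Suc s) cs)) (run \<omega> s) \<omega>"
    by (rule active_cong) simp
  then show ?thesis
    using assms unfolding nth_acts[OF assms] elim_choice_def acts_restrict[OF order_refl] by simp
qed

lemma deviation_prob:
  assumes env: "environment K M T \<mu> P" and t: "t < T" and n: "n \<in> {1..T}"
    and c: "c \<in> {1..M}" and a: "a \<in> {1..K}"
  shows "deviation t n c a \<in> sets P" "measure P (deviation t n c a) \<le> 2 * exp (- r)"
proof -
  interpret sampled_sequence P "reward_space K M" "\<lambda>t \<omega>. \<omega> t" T
    "\<lambda>s h. (elim_choice K E r (take (Suc s) cs) (run h s) h, a) \<in> E"
    using env by (rule sampled_run)
  have space: "space P = space (table_space K M T)"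
    using env by (rule environment_space)
  \<comment> \<open>Recomputing a choice from the truncated table gives the actual action, so the
    sampled indices are exactly the rounds that see \<open>a\<close>.\<close>
  have sampled: "sampled t \<omega> = sees E (run \<omega> t) a" for \<omega>
    unfolding sees_def length_acts
  proof (intro Collect_cong conj_cong refl)
    fix s assume "s \<in> {..<t}"
    then have "s < t" by simp
    show "((elim_choice K E r (take (Suc s) cs) (run (restrict \<omega> {..<s}) s) (restrict \<omega> {..<s}), a) \<in> E)
        = ((run \<omega> t ! s, a) \<in> E)"
      unfolding choice_restrict[OF \<open>s < t\<close>] by (rule refl)
  qed
  have g: "(\<lambda>y. y (c, a)) \<in> borel_measurable (reward_space K M)"
    using c a by (intro measurable_component_singleton) auto
  have dev: "deviation t n c a = {\<omega> \<in> space P. card (sampled t \<omega>) = n \<and>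
      \<bar>\<Sum>s\<in>sampled t \<omega>. \<omega> s (c, a) - \<mu> c a\<bar> \<ge> sqrt (n * r / 2)}"
    unfolding deviation_def sampled space by simp
  have [measurable]: "(\<lambda>\<omega>. card (sampled t \<omega>)) \<in> measurable P (count_space UNIV)"
    "(\<lambda>\<omega>. \<Sum>s\<in>sampled t \<omega>. \<omega> s (c, a) - \<mu> c a) \<in> borel_measurable P"
    using t by (intro sampled_measurable sampled_sum_measurable[OF _ g]; simp)+
  show "deviation t n c a \<in> sets P"
    unfolding dev by measurable
  have "measure P (deviation t n c a) \<le> 2 * exp (- 2 * (sqrt (n * r / 2))\<^sup>2 / n)"
    unfolding dev
  proof (rule sampled_sum_tail[OF g])
    show "AE \<omega> in P. \<omega> s (c, a) \<in> {0..1}" "expectation (\<lambda>\<omega>. \<omega> s (c, a)) = \<mu> c a" if "s < T" for s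
      using env that c a by (auto simp: environment_def)
  qed (use t n r in auto)
  also have "- 2 * (sqrt (n * r / 2))\<^sup>2 / n = - r"
    using n r by (simp add: field_simps)
  finally show "measure P (deviation t n c a) \<le> 2 * exp (- r)" .
qed

lemma deviations_prob:
  assumes env: "environment K M T \<mu> P"
  shows "deviations \<in> sets P" "measure P deviations \<le> 2 * real (T * T * M * K) * exp (- r)"
proof -
  interpret prob_space P
    using env by (simp add: environment_def)
  let ?I = "{..<T} \<times> {1..T} \<times> {1..M} \<times> {1..K}"
  let ?D = "\<lambda>(t, n, c, a). deviation t n c a"
  have D: "?D i \<in> sets P" "measure P (?D i) \<le> 2 * exp (- r)" if "i \<in> ?I" for i
    using that deviation_prob[OF env] by auto
  then show "deviations \<in> sets P"
    unfolding deviations_def by (intro sets.finite_UN) auto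
  have "measure P deviations \<le> (\<Sum>i\<in>?I. measure P (?D i))"
    unfolding deviations_def using D(1) by (intro finite_measure_subadditive_finite) auto
  also have "\<dots> \<le> (\<Sum>i\<in>?I. 2 * exp (- r))"
    by (intro sum_mono D(2))
  also have "\<dots> = 2 * real (T * T * M * K) * exp (- r)"
    by (simp add: card_cartesian_product)
  finally show "measure P deviations \<le> 2 * real (T * T * M * K) * exp (- r)" .
qed

text \<open>Off \<open>deviations\<close> the regret is at most \<open>regret_bound\<close>; on that
  event the trivial bound \<open>T\<close> is paid.\<close>

lemma expected_regret_le:
  assumes env: "environment K M T \<mu> P"
  shows "expected_regret K M E (elim_policy K E r) cs \<mu> P
    \<le> regret_bound + T * (2 * real (T * T * M * K) * exp (- r))"
proof -
  interpret prob_space P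
    using env by (simp add: environment_def)
  have space: "space P = space (table_space K M T)"
    using env by (rule environment_space)
  have eq: "expected_regret K M E (elim_policy K E r) cs \<mu> P = (\<integral>\<omega>. pseudo_regret K \<mu> cs (run \<omega> T) \<partial>P)"
    unfolding expected_regret_def length_cs play_elim_policy[OF cs order_refl] by simp
  have ind: "integrable P (indicat_real deviations)"
    using deviations_prob(1)[OF env]
    by (intro integrable_real_indicator) (auto simp: emeasure_eq_measure)
  then have int: "integrable P (\<lambda>\<omega>. regret_bound + real T * indicat_real deviations \<omega>)"
    by (intro Bochner_Integration.integrable_add integrable_mult_right) auto
  have "(\<integral>\<omega>. pseudo_regret K \<mu> cs (run \<omega> T) \<partial>P) \<le> (\<integral>\<omega>. regret_bound + real T * indicat_real deviations \<omega> \<partial>P)"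
  \<comment> \<open>Integrability is asked of the dominating function alone; a non-integrable
    integrand would have integral 0, whence the extra goal that the bound is nonnegative.\<close>
  proof (rule integral_mono')
    fix \<omega> assume \<omega>: "\<omega> \<in> space P"
    show "pseudo_regret K \<mu> cs (run \<omega> T) \<le> regret_bound + real T * indicat_real deviations \<omega>"
    proof (cases "\<omega> \<in> deviations")
      case True
      then show ?thesis
        using pseudo_regret_le[of \<omega>] regret_bound_nonneg by simp
    next
      case False
      then show ?thesis
        using pseudo_regret_good[OF concentrated_or_deviation] \<omega> space by simp
    qed
    show "0 \<le> regret_bound + real T * indicat_real deviations \<omega>"
      using regret_bound_nonneg by simp
  qed (rule int)
  also have "\<dots> = regret_bound + T * measure P deviations"
    using deviations_prob(1)[OF env] ind
    by (subst Bochner_Integration.integral_add) (auto simp: prob_space)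
  also have "\<dots> \<le> regret_bound + T * (2 * real (T * T * M * K) * exp (- r))"
    using deviations_prob(2)[OF env] by (intro add_mono mult_left_mono) auto
  finally show ?thesis
    unfolding eq .
qed

end

section \<open>Choice of the confidence level and the constants\<close>

theorem theorem1p3:
  "\<exists>(C::real) (d::nat). C > 0 \<and>
     (\<forall>(K::nat) (M::nat) (T::nat) (E :: nat rel).
        K \<ge> 1 \<and> M \<ge> 1 \<and> T \<ge> 1 \<and> digraph_on K E \<and> strongly_observable K E \<longrightarrow>
        (\<exists>\<pi>. valid_policy K M T \<pi> \<and>
             regret K M T E \<pi> \<le>
               ereal (C * (1 + ln (real (K * M * T))) ^ d *
                      sqrt (real (min (beta_bar M K E) (mas_number K E)) * real T))))"
proof (rule exI[of _ 17], rule exI[of _ 2], intro conjI allI impI)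
  fix K M T :: nat and E :: "nat rel"
  assume *: "K \<ge> 1 \<and> M \<ge> 1 \<and> T \<ge> 1 \<and> digraph_on K E \<and> strongly_observable K E"
  then have K: "K \<ge> 1" and M: "M \<ge> 1" and T: "T \<ge> 1" and obs: "strongly_observable K E"
    by auto
  define l where "l = 1 + ln (real (K * M * T))"
  define m where "m = real (min (beta_bar M K E) (mas_number K E))"
  \<comment> \<open>Then \<open>exp (- r)\<close> is \<open>exp (- 3)\<close> divided by the cube of
    \<open>K * M * T\<close>, which outweighs \<open>2 * T^3 * M * K\<close>, the union bound times
    the trivial regret \<open>T\<close>.\<close>
  define r where "r = 3 * l"
  have KMT: "K * M * T \<ge> 1" "K \<le> K * M * T" "T \<le> K * M * T"
    using K M T by simp_all
  have l: "l \<ge> 1" "1 + ln (real K) \<le> l" "1 + ln (real T) \<le> l"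
    using K T KMT(1) of_nat_mono[OF KMT(2), where 'a = real] of_nat_mono[OF KMT(3), where 'a = real]
    unfolding l_def by (auto simp del: of_nat_mult)
  have m: "m \<ge> 1"
    using beta_bar_ge_1[OF K M, of E] mas_number_ge_1[OF K, of E] unfolding m_def by simp
  have mT: "1 \<le> m * T"
    using m T by (metis mult_mono' mult_1 of_nat_1 of_nat_mono zero_le_one)
  have small: "T * (2 * real (T * T * M * K) * exp (- r)) \<le> 1"
  proof -
    let ?x = "real (K * M * T)"
    have x: "?x \<ge> 1" using KMT(1) by (metis of_nat_1 of_nat_mono)
    have "exp (3 * ln ?x) = ?x ^ 3"
      using x exp_of_nat_mult[of 3 "ln ?x"] by (simp del: of_nat_mult)
    then have "exp r = exp 3 * ?x ^ 3"
      by (simp add: r_def l_def distrib_left exp_add del: of_nat_mult)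
    moreover have "T * (2 * real (T * T * M * K)) \<le> exp 3 * ?x ^ 3"
    proof -
      have "T * (T * T * M * K) \<le> (K * M * T) * ((K * M * T) * (K * M * T))"
      proof -
        have "(K * M * T) * ((K * M * T) * (K * M * T)) = T * (T * T * M * K) * ((K * M) * (K * M))"
          by (simp add: mult_ac)
        then show ?thesis using K M by simp
      qed
      then have "real (T * (T * T * M * K)) \<le> ?x ^ 3"
        unfolding power3_eq_cube of_nat_mult[symmetric] by (intro of_nat_mono) (simp only: mult_ac)
      moreover have "2 \<le> exp (3::real)"
        using exp_ge_add_one_self[of 3] by linarith
      ultimately have "2 * real (T * (T * T * M * K)) \<le> exp 3 * ?x ^ 3"
        by (intro mult_mono) auto
      then show ?thesis by (simp add: mult_ac)
    qed
    ultimately have "T * (2 * real (T * T * M * K)) \<le> exp r"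
      by simp
    then show ?thesis
      by (simp add: exp_minus field_simps)
  qed
  have effort: "effort K M E = 5 * (1 + ln K) * m"
    by (simp add: effort_def m_def)
  have bound: "expected_regret K M E (elim_policy K E r) cs \<mu> P \<le> 17 * l ^ 2 * sqrt (m * T)"
    if cs: "cs \<in> context_seqs M T" and env: "environment K M T \<mu> P" for cs \<mu> P
  proof -
    interpret elimination_run K M T E r cs \<mu>
      using K M T obs cs env l(1) by unfold_locales (auto simp: r_def environment_def)
    have "r * T * effort K M E * (1 + ln T) = 15 * (l * (1 + ln K) * (1 + ln T)) * (m * T)"
      unfolding effort r_def by (simp add: algebra_simps)
    also have "\<dots> \<le> 15 * (l * l * l) * (m * T)"
      using l K T m by (intro mult_mono mult_nonneg_nonneg) auto
    \<comment> \<open>The 15 is 3 from \<open>r\<close> times 5 from \<open>effort\<close>; rounding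
      up to \<open>16 * l^4\<close> gives a perfect square, so the exponent of the logarithm becomes
      2.\<close>
    also have "\<dots> \<le> 16 * (l * l * l * l) * (m * T)"
      using l m mult_mono[of 15 16 "l * l * l * 1" "l * l * l * l"] by (intro mult_right_mono) auto
    also have "\<dots> = (4 * l ^ 2) ^ 2 * (m * T)"
      by (simp add: power2_eq_square)
    finally have "sqrt (r * T * effort K M E * (1 + ln T)) \<le> sqrt ((4 * l ^ 2) ^ 2 * (m * T))"
      by (rule real_sqrt_le_mono)
    also have "\<dots> = 4 * l ^ 2 * sqrt (m * T)"
      by (subst real_sqrt_mult, subst real_sqrt_abs) simp
    finally have "regret_bound \<le> 16 * l ^ 2 * sqrt (m * T)"
      unfolding regret_bound_def by linarith
    \<comment> \<open>Absorbs the failure term, which is at most 1, and raises 16 to 17.\<close>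
    moreover have "1 * 1 \<le> l ^ 2 * sqrt (m * T)"
      using l(1) mT by (intro mult_mono) auto
    ultimately show ?thesis
      using expected_regret_le[OF env] small by linarith
  qed
  show "\<exists>\<pi>. valid_policy K M T \<pi> \<and>
      regret K M T E \<pi> \<le> ereal (17 * (1 + ln (real (K * M * T))) ^ 2 *
        sqrt (real (min (beta_bar M K E) (mas_number K E)) * real T))"
  proof (intro exI conjI)
    show "valid_policy K M T (elim_policy K E r)"
      using K by (rule valid_elim_policy)
    show "regret K M T E (elim_policy K E r) \<le> ereal (17 * (1 + ln (real (K * M * T))) ^ 2 *
        sqrt (real (min (beta_bar M K E) (mas_number K E)) * real T))"
      unfolding regret_def
      using bound unfolding l_def m_def by (auto intro!: SUP_least)
  qed
qed simp

end
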